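(* Let $H$ be a Hilbert space, let $\alpha\in(0,1)$ and $\eta\ge 0$, and let $\mathcal{A}:\mathcal{D}(\mathcal{A})\subset H\to H$ be an m-dissipative operator on $H$. Then $\mathcal{A}$ generates a solution operator $(S_{\alpha,\eta}(t))_{t\ge 0}$ (i.e. problem (P) of the context admits a solution operator), and the Cauchy problem $$ \partial_t^{\alpha,\eta}u(t)=\mathcal{A}u(t)-\frac{\eta}{\Gamma(1-\alpha)}\int_0^t(t-s)^{-\alpha}e^{-\eta(t-s)}u(s)\,ds,\quad t>0,\qquad u(0)=u^0, $$ is well-posed. In particular, when $\eta>0$ this system is exponentially stable: there exists $M>0$ such that $$ \|S_{\alpha,\eta}(t)u^0\|_H\le M e^{-\eta t}\|u^0\|_H,\qquad \forall\,u^0\in\mathcal{D}(\mathcal{A}),\ t\ge 0. $$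
   Context: Notation: $\mathbb{R}_+=[0,\infty)$; $(a*u)(t)=\int_0^t a(t-s)u(s)\,ds$; for $\beta>0$, $g_\beta(t)=\frac{t^{\beta-1}}{\Gamma(\beta)}$ for $t>0$ and $g_\beta(t)=0$ for $t\le 0$. $\mathcal{D}(\mathcal{A})$ carries the graph norm; $\mathcal{L}(H)$ is the space of bounded linear operators on $H$. The fractional derivative is $\partial_t^{\alpha,\eta}v(t)=\frac{1}{\Gamma(1-\alpha)}\int_0^t(t-s)^{-\alpha}e^{-\eta(t-s)}v'(s)\,ds$, for $0<\alpha<1$, $\eta\ge0$. Problem (P) denotes the Cauchy problem displayed in the claim. Setting $v(t)=e^{\eta t}u(t)$, it is equivalent to $\mathbf{D}_t^\alpha v(t)=\mathcal{A}v(t)$, $t>0$, $v(0)=u^0$, where $\mathbf{D}_t^\alpha v$ is the Caputo derivative, $\mathbf{D}_t^\alpha v=g_{1-\alpha}*v'=\big(g_{1-\alpha}*(v-v(0))\big)'$. For strong solutions as defined below, (P) is understood as $\big(g_{1-\alpha}*(v-u^0)\big)'(t)=\mathcal{A}v(t)$. Solution operator: a family $(S_{\alpha,\eta}(t))_{t\ge0}\subset\mathcal{L}(H)$ is a solution operator (or resolvent) for (P) if (a) $S_{\alpha,\eta}(t)$ is strongly continuous for $t\ge0$ and $S_{\alpha,\eta}(0)=I$; (b) $S_{\alpha,\eta}(t)(\mathcal{D}(\mathcal{A}))\subset\mathcal{D}(\mathcal{A})$ and $\mathcal{A}S_{\alpha,\eta}(t)x=S_{\alpha,\eta}(t)\mathcal{A}x$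 for all $x\in\mathcal{D}(\mathcal{A})$, $t\ge0$; (c) $S_{\alpha,\eta}(t)x=e^{-\eta t}x+e^{-\eta t}\big(g_\alpha*(e^{\eta\cdot}\mathcal{A}S_{\alpha,\eta}(\cdot)x)\big)(t)$ for all $x\in\mathcal{D}(\mathcal{A})$, $t\ge0$. Strong solution: $u\in\mathcal{C}(\mathbb{R}_+,H)$ is a strong solution of (P) if $u\in\mathcal{C}(\mathbb{R}_+,\mathcal{D}(\mathcal{A}))$, $g_{1-\alpha}*(e^{\eta\cdot}u-u^0)\in\mathcal{C}^1(\mathbb{R}_+,H)$ and (P) holds on $\mathbb{R}_+$. Well-posedness: (P) is well-posed if for every $u^0\in\mathcal{D}(\mathcal{A})$ there is a unique strong solution $u(t,u^0)$, and whenever $u_n^0\in\mathcal{D}(\mathcal{A})$ with $u_n^0\to0$ in $H$, then $u(t,u_n^0)\to0$ in $H$ uniformly on compact time intervals. *)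

theory Defs
  imports "HOL-Analysis.Analysis"
begin

text \<open>
  A Hilbert space over the scalar field \<open>\<K>\<close>, which is \<open>\<real>\<close> or the whole of \<open>\<complex>\<close>.  The carrier type
  supplies the underlying real Hilbert space (addition, real scaling, norm, completeness), whose real
  inner product is the real part of the scalar product \<open>ip\<close>.  The value of \<open>sc c x\<close>
  is irrelevant for \<open>c\<close> outside the scalar field.
\<close>
locale hilbert_space =
  fixes K :: "complex set"
    and sc :: "complex \<Rightarrow> 'a::{real_inner,complete_space} \<Rightarrow> 'a"
    and ip :: "'a \<Rightarrow> 'a \<Rightarrow> complex"
  assumes scalars: "K = \<real> \<or> K = UNIV"
    and sc_of_real: "sc (complex_of_real r) x = r *\<^sub>R x"
    and sc_add_right: "c \<in> K \<Longrightarrow> sc c (x + y) = sc c x + sc c y"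
    and sc_add_left: "\<lbrakk>c \<in> K; d \<in> K\<rbrakk> \<Longrightarrow> sc (c + d) x = sc c x + sc d x"
    and sc_mult: "\<lbrakk>c \<in> K; d \<in> K\<rbrakk> \<Longrightarrow> sc (c * d) x = sc c (sc d x)"
    and ip_scalar: "ip x y \<in> K"
    and ip_add_left: "ip (x + y) z = ip x z + ip y z"
    and ip_sc_left: "c \<in> K \<Longrightarrow> ip (sc c x) y = c * ip x y"
    and ip_commute: "ip y x = cnj (ip x y)"
    and Re_ip: "Re (ip x y) = x \<bullet> y"

text \<open>Every real Hilbert space is covered, and so is the complex line.\<close>

lemma hilbert_space_real:
  "hilbert_space \<real> (\<lambda>c x. Re c *\<^sub>R x)
     (\<lambda>x y :: 'a::{real_inner,complete_space}. complex_of_real (x \<bullet> y))"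
  by standard (auto simp: algebra_simps inner_commute complex_is_Real_iff complex_eq_iff)

lemma hilbert_space_complex: "hilbert_space UNIV (*) (\<lambda>x y :: complex. x * cnj y)"
  by standard (auto simp: algebra_simps scaleR_conv_of_real inner_complex_def)

text \<open>
  An unbounded operator is a function \<open>A\<close> together with its domain \<open>D\<close>; values of \<open>A\<close> off \<open>D\<close> are
  irrelevant.
\<close>
definition linear_operator ::
    "complex set \<Rightarrow> (complex \<Rightarrow> 'a::real_vector \<Rightarrow> 'a) \<Rightarrow> 'a set \<Rightarrow> ('a \<Rightarrow> 'a) \<Rightarrow> bool" where
  "linear_operator K sc D A \<longleftrightarrow>
     0 \<in> D \<and>
     (\<forall>x\<in>D. \<forall>y\<in>D. x + y \<in> D \<and> A (x + y) = A x + A y) \<and>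
     (\<forall>c\<in>K. \<forall>x\<in>D. sc c x \<in> D \<and> A (sc c x) = sc c (A x))"

definition dissipative :: "('a \<Rightarrow> 'a \<Rightarrow> complex) \<Rightarrow> 'a set \<Rightarrow> ('a \<Rightarrow> 'a) \<Rightarrow> bool" where
  "dissipative ip D A \<longleftrightarrow> (\<forall>x\<in>D. Re (ip (A x) x) \<le> 0)"

text \<open>
  The range condition is required for one positive \<open>r\<close> only (equivalently, for all of them).  Density
  of the domain is not assumed: in a Hilbert space it follows.
\<close>
definition m_dissipative ::
    "complex set \<Rightarrow> (complex \<Rightarrow> 'a::real_vector \<Rightarrow> 'a) \<Rightarrow> ('a \<Rightarrow> 'a \<Rightarrow> complex) \<Rightarrow>
     'a set \<Rightarrow> ('a \<Rightarrow> 'a) \<Rightarrow> bool" where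
  "m_dissipative K sc ip D A \<longleftrightarrow>
     linear_operator K sc D A \<and> dissipative ip D A \<and>
     (\<exists>r::real. r > 0 \<and> (\<lambda>x. r *\<^sub>R x - A x) ` D = UNIV)"

definition bounded_operator ::
    "complex set \<Rightarrow> (complex \<Rightarrow> 'a::real_normed_vector \<Rightarrow> 'a) \<Rightarrow> ('a \<Rightarrow> 'a) \<Rightarrow> bool" where
  "bounded_operator K sc T \<longleftrightarrow>
     bounded_linear T \<and> (\<forall>c\<in>K. \<forall>x. T (sc c x) = sc c (T x))"

definition g :: "real \<Rightarrow> real \<Rightarrow> real" where
  "g \<beta> t = (if t > 0 then t powr (\<beta> - 1) / Gamma \<beta> else 0)"

text \<open>
  The Henstock--Kurzweil integral is used because the Bochner integral of the library is confined to
  separable spaces.  For an integrable kernel such as \<open>g \<beta>\<close> with \<open>\<beta> > 0\<close> and a continuous \<open>u\<close>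
  the two agree.
\<close>
definition conv :: "(real \<Rightarrow> real) \<Rightarrow> (real \<Rightarrow> 'a::real_normed_vector) \<Rightarrow> real \<Rightarrow> 'a" where
  "conv a u t = integral {0..t} (\<lambda>s. a (t - s) *\<^sub>R u s)"

definition solution_operator ::
    "complex set \<Rightarrow> (complex \<Rightarrow> 'a::real_normed_vector \<Rightarrow> 'a) \<Rightarrow> real \<Rightarrow> real \<Rightarrow>
     'a set \<Rightarrow> ('a \<Rightarrow> 'a) \<Rightarrow> (real \<Rightarrow> 'a \<Rightarrow> 'a) \<Rightarrow> bool" where
  "solution_operator K sc \<alpha> \<eta> D A S \<longleftrightarrow>
     (\<forall>t\<ge>0. bounded_operator K sc (S t)) \<and>
     (\<forall>x. continuous_on {0..} (\<lambda>t. S t x)) \<and>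
     (\<forall>x. S 0 x = x) \<and>
     (\<forall>t\<ge>0. \<forall>x\<in>D. S t x \<in> D \<and> A (S t x) = S t (A x)) \<and>
     (\<forall>t\<ge>0. \<forall>x\<in>D. S t x = exp (- \<eta> * t) *\<^sub>R x +
        exp (- \<eta> * t) *\<^sub>R conv (g \<alpha>) (\<lambda>s. exp (\<eta> * s) *\<^sub>R A (S s x)) t)"

definition graph_norm :: "('a \<Rightarrow> 'a) \<Rightarrow> 'a::real_normed_vector \<Rightarrow> real" where
  "graph_norm A x = norm x + norm (A x)"

definition continuous_in_domain ::
    "'a set \<Rightarrow> ('a \<Rightarrow> 'a) \<Rightarrow> (real \<Rightarrow> 'a::real_normed_vector) \<Rightarrow> bool" where
  "continuous_in_domain D A u \<longleftrightarrow>
     (\<forall>t\<ge>0. u t \<in> D) \<and>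
     (\<forall>t\<ge>0. ((\<lambda>s. graph_norm A (u s - u t)) \<longlongrightarrow> 0) (at t within {0..}))"

text \<open>The fractional derivative of \<open>v\<close> and the right-hand side of the Cauchy problem in its original form.\<close>

definition frac_deriv :: "real \<Rightarrow> real \<Rightarrow> (real \<Rightarrow> 'a::real_normed_vector) \<Rightarrow> real \<Rightarrow> 'a" where
  "frac_deriv \<alpha> \<eta> v t = (1 / Gamma (1 - \<alpha>)) *\<^sub>R integral {0..t}
     (\<lambda>s. ((t - s) powr (- \<alpha>) * exp (- \<eta> * (t - s))) *\<^sub>R
            vector_derivative v (at s within {0..}))"

definition cauchy_rhs ::
    "real \<Rightarrow> real \<Rightarrow> ('a \<Rightarrow> 'a) \<Rightarrow> (real \<Rightarrow> 'a::real_normed_vector) \<Rightarrow> real \<Rightarrow> 'a" where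
  "cauchy_rhs \<alpha> \<eta> A u t = A (u t) - (\<eta> / Gamma (1 - \<alpha>)) *\<^sub>R integral {0..t}
     (\<lambda>s. ((t - s) powr (- \<alpha>) * exp (- \<eta> * (t - s))) *\<^sub>R u s)"

text \<open>
  For differentiable \<open>u\<close> the equation is equivalent to \<open>g (1 - \<alpha>) * v' = A v\<close>, where
  \<open>v t = e\<^bsup>\<eta>t\<^esup> u t\<close>.
\<close>
lemma cauchy_problem_Caputo:
  fixes u :: "real \<Rightarrow> 'a::{real_inner,complete_space}"
  assumes lin: "linear_operator K sc D A" and hs: "hilbert_space K sc ip"
    and \<alpha>: "\<alpha> < 1" and t: "t > 0" and D: "u t \<in> D"
    and u': "\<And>s. s \<ge> 0 \<Longrightarrow> (u has_vector_derivative u' s) (at s within {0..})"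
    and int: "(\<lambda>s. ((t - s) powr (- \<alpha>) * exp (- \<eta> * (t - s))) *\<^sub>R u s) integrable_on {0..t}"
    and int': "(\<lambda>s. ((t - s) powr (- \<alpha>) * exp (- \<eta> * (t - s))) *\<^sub>R u' s) integrable_on {0..t}"
  defines "v \<equiv> \<lambda>s. exp (\<eta> * s) *\<^sub>R u s"
  shows "frac_deriv \<alpha> \<eta> u t = cauchy_rhs \<alpha> \<eta> A u t \<longleftrightarrow>
    conv (g (1 - \<alpha>)) (\<lambda>s. vector_derivative v (at s within {0..})) t = A (v t)"
proof -
  interpret hilbert_space K sc ip by (rule hs)
  define k where "k = (\<lambda>s. (t - s) powr (- \<alpha>) * exp (- \<eta> * (t - s)))"
  define c where "c = 1 / Gamma (1 - \<alpha>)"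
  have nt: "at s within {0..} \<noteq> bot" if "s \<ge> 0" for s :: real
  proof
    assume "at s within {0..} = bot"
    moreover have "at s within {s<..} \<le> at s within {0..}"
      using that by (intro at_le) auto
    ultimately show False
      by (simp add: bot_unique)
  qed
  have du: "vector_derivative u (at s within {0..}) = u' s" if "s \<ge> 0" for s
    by (rule vector_derivative_within[OF nt[OF that] u'[OF that]])
  have dv: "vector_derivative v (at s within {0..}) = exp (\<eta> * s) *\<^sub>R (u' s + \<eta> *\<^sub>R u s)"
    if "s \<ge> 0" for s
  proof -
    have "((\<lambda>s. exp (\<eta> * s)) has_field_derivative exp (\<eta> * s) * \<eta>) (at s within {0..})"
      by (auto intro!: derivative_eq_intros)
    from has_vector_derivative_scaleR[OF this u'[OF that]]
    have "(v has_vector_derivative exp (\<eta> * s) *\<^sub>R (u' s + \<eta> *\<^sub>R u s)) (at s within {0..})"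
      by (simp add: v_def algebra_simps)
    then show ?thesis by (rule vector_derivative_within[OF nt[OF that]])
  qed
  have A: "A (v t) = exp (\<eta> * t) *\<^sub>R A (u t)"
  proof -
    have "complex_of_real (exp (\<eta> * t)) \<in> K" using scalars by auto
    then have "A (sc (complex_of_real (exp (\<eta> * t))) (u t)) =
        sc (complex_of_real (exp (\<eta> * t))) (A (u t))"
      using lin D unfolding linear_operator_def by blast
    then show ?thesis by (simp add: sc_of_real v_def)
  qed
  have k: "g (1 - \<alpha>) (t - s) * exp (\<eta> * s) = exp (\<eta> * t) * c * k s" if "s \<le> t" for s
    using that by (auto simp: g_def k_def c_def algebra_simps simp flip: exp_add)
  have "conv (g (1 - \<alpha>)) (\<lambda>s. vector_derivative v (at s within {0..})) t =
      integral {0..t} (\<lambda>s. (exp (\<eta> * t) * c) *\<^sub>R (k s *\<^sub>R u' s + \<eta> *\<^sub>R (k s *\<^sub>R u s)))"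
    unfolding conv_def
  proof (rule integral_cong)
    fix s assume "s \<in> {0..t}"
    then have s: "s \<ge> 0" "s \<le> t" by auto
    have "g (1 - \<alpha>) (t - s) *\<^sub>R vector_derivative v (at s within {0..}) =
        (g (1 - \<alpha>) (t - s) * exp (\<eta> * s)) *\<^sub>R (u' s + \<eta> *\<^sub>R u s)"
      by (simp add: dv[OF s(1)])
    also have "\<dots> = (exp (\<eta> * t) * c) *\<^sub>R (k s *\<^sub>R u' s + \<eta> *\<^sub>R (k s *\<^sub>R u s))"
      unfolding k[OF s(2)] by (simp add: scaleR_add_right ac_simps)
    finally show "g (1 - \<alpha>) (t - s) *\<^sub>R vector_derivative v (at s within {0..}) =
        (exp (\<eta> * t) * c) *\<^sub>R (k s *\<^sub>R u' s + \<eta> *\<^sub>R (k s *\<^sub>R u s))" .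
  qed
  also have "\<dots> = (exp (\<eta> * t) * c) *\<^sub>R
      (integral {0..t} (\<lambda>s. k s *\<^sub>R u' s) + \<eta> *\<^sub>R integral {0..t} (\<lambda>s. k s *\<^sub>R u s))"
  proof -
    have i: "(\<lambda>s. k s *\<^sub>R u s) integrable_on {0..t}" "(\<lambda>s. k s *\<^sub>R u' s) integrable_on {0..t}"
      using int int' by (simp_all only: k_def)
    show ?thesis
      by (simp only: integral_cmul integral_add[OF i(2) integrable_cmul[OF i(1)]])
  qed
  also have "\<dots> = exp (\<eta> * t) *\<^sub>R (frac_deriv \<alpha> \<eta> u t - (cauchy_rhs \<alpha> \<eta> A u t - A (u t)))"
  proof -
    have "frac_deriv \<alpha> \<eta> u t = c *\<^sub>R integral {0..t} (\<lambda>s. k s *\<^sub>R u' s)"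
      unfolding frac_deriv_def c_def k_def by (intro arg_cong[where f = "scaleR _"] integral_cong) (simp add: du)
    then show ?thesis by (simp add: cauchy_rhs_def c_def k_def algebra_simps)
  qed
  finally show ?thesis
    by (auto simp: A algebra_simps)
qed

text \<open>
  A strong solution need not be differentiable, so the left-hand side \<open>g (1 - \<alpha>) * v'\<close> is taken in
  the form \<open>(g (1 - \<alpha>) * (v - u0))'\<close>.  The witness \<open>w\<close> below is this derivative (one-sided at 0).
\<close>
definition strong_solution ::
    "real \<Rightarrow> real \<Rightarrow> 'a set \<Rightarrow> ('a \<Rightarrow> 'a) \<Rightarrow> 'a::real_normed_vector \<Rightarrow> (real \<Rightarrow> 'a) \<Rightarrow> bool" where
  "strong_solution \<alpha> \<eta> D A u0 u \<longleftrightarrow>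
     continuous_on {0..} u \<and>
     continuous_in_domain D A u \<and>
     u 0 = u0 \<and>
     (\<exists>w. continuous_on {0..} w \<and>
        (\<forall>t\<ge>0. (conv (g (1 - \<alpha>)) (\<lambda>s. exp (\<eta> * s) *\<^sub>R u s - u0) has_vector_derivative w t)
                 (at t within {0..})) \<and>
        (\<forall>t\<ge>0. w t = A (exp (\<eta> * t) *\<^sub>R u t)))"

definition well_posed ::
    "real \<Rightarrow> real \<Rightarrow> 'a set \<Rightarrow> ('a \<Rightarrow> 'a::real_normed_vector) \<Rightarrow> bool" where
  "well_posed \<alpha> \<eta> D A \<longleftrightarrow>
     (\<forall>u0\<in>D. \<exists>u. strong_solution \<alpha> \<eta> D A u0 u) \<and>
     (\<forall>u0\<in>D. \<forall>u v. strong_solution \<alpha> \<eta> D A u0 u \<longrightarrow> strong_solution \<alpha> \<eta> D A u0 v \<longrightarrow>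
        (\<forall>t\<ge>0. u t = v t)) \<and>
     (\<forall>u0 u. (\<forall>n::nat. u0 n \<in> D \<and> strong_solution \<alpha> \<eta> D A (u0 n) (u n)) \<longrightarrow> u0 \<longlonglongrightarrow> 0 \<longrightarrow>
        (\<forall>T\<ge>0. uniform_limit {0..T} u (\<lambda>_. 0) sequentially))"

end

theory Submission imports Defs begin

text \<open>
  With \<open>v t = e\<^bsup>\<eta>t\<^esup> u t\<close> the Cauchy problem becomes the Volterra equation \<open>v = x + g \<alpha> * A v\<close>, in which
  \<open>\<eta>\<close> no longer occurs. It therefore suffices to construct a family of contractions \<open>sol t\<close> solving
  this equation and to prove uniqueness; the factor \<open>e\<^bsup>-\<eta>t\<^esup>\<close> of the original variable then gives
  both well-posedness and the exponential decay, with the constant \<open>M = 1\<close>.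

  The one analytic fact behind all estimates is \<open>energy_inequality\<close>: if \<open>norm (v s)\<close>, \<open>0 \<le> s \<le> \<tau>\<close>, is
  largest at \<open>s = \<tau> > 0\<close>, then the Caputo derivative \<open>f\<close> of \<open>v\<close> at \<open>\<tau>\<close>, for the initial value \<open>x\<close>, satisfies
  \<open>f \<bullet> v \<tau> \<ge> g (1 - \<alpha>) \<tau> * ((norm (v \<tau>))\<^sup>2 - x \<bullet> v \<tau>)\<close>. This is a maximum principle: the kernel
  \<open>g (1 - \<alpha>)\<close> decreases, so past values that do not exceed the present one can only increase the
  derivative. If \<open>f = B (v \<tau>)\<close> with \<open>B\<close> dissipative, the left-hand side is at most 0 and
  \<open>norm (v \<tau>) \<le> norm x\<close> follows. The inequality needs \<open>v\<close> to be Lipschitz to the left of \<open>\<tau>\<close>, which a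
  solution with a merely continuous right-hand side need not be, so it is applied to more regular
  functions.

  \<^item> Existence. The Yosida approximations \<open>A\<^sub>n\<close> are bounded and dissipative. For a bounded operator the
    equation is solved by the Mittag-Leffler series \<open>\<Sum>k. t\<^bsup>k\<alpha>\<^esup> / \<Gamma>(k\<alpha> + 1) B\<^sup>k x\<close>, which is Lipschitz away
    from \<open>t = 0\<close>. The energy inequality shows that these approximate solutions are contractions
    (\<open>norm_mittag_leffler_le\<close>) and that two of them differ by at most
    \<open>\<Gamma>(1 - \<alpha>) t\<^bsup>\<alpha>\<^esup> norm (A\<^sub>n x - A\<^sub>m x)\<close> (\<open>norm_V_diff_le\<close>). Since \<open>A\<^sub>n x\<close> converges to \<open>A x\<close> on the domain,
    and the domain is dense, they converge uniformly on compact intervals. The limit commutes with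
    the resolvent of \<open>A\<close> and hence preserves the domain.

  \<^item> Uniqueness. The difference of two strong solutions is integrated once; the integral is
    continuously differentiable and solves the same equation with zero initial value, so the energy
    inequality applies and the integral vanishes (\<open>zero_solution\<close>).

  Strong solutions and the integral equation are linked by the semigroup law
  \<open>g a * (g b * f) = g (a + b) * f\<close> (\<open>conv_conv\<close>). It is verified for powers of \<open>t\<close>, where it is Euler's
  Beta integral, and extended to continuous functions by the Weierstrass approximation theorem and
  to Hilbert space valued functions by taking inner products.
\<close>

section \<open>Integration in a complete normed space\<close>

text \<open>
  A type variable of the sort \<open>{real_normed_vector,complete_space}\<close> is not formally of class \<open>banach\<close>,
  although the class adds no axiom to the two. An isometric copy of the type can be declared an
  instance of it.
\<close>

typedef (overloaded) 'a banach_copy = "UNIV :: 'a::{real_normed_vector,complete_space} set"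
  morphisms of_copy to_copy ..

instantiation banach_copy :: ("{real_normed_vector,complete_space}") real_normed_vector
begin

definition "0 = to_copy 0"
definition "x + y = to_copy (of_copy x + of_copy y)"
definition "x - y = to_copy (of_copy x - of_copy y)"
definition "- x = to_copy (- of_copy x)"
definition "r *\<^sub>R x = to_copy (r *\<^sub>R of_copy x)"
definition "norm x = norm (of_copy x)"
definition "sgn x = inverse (norm x) *\<^sub>R (x :: 'a banach_copy)"
definition "dist x y = norm (x - y :: 'a banach_copy)"
definition "uniformity = (INF e\<in>{0 <..}. principal {(x, y). dist x y < (e::real)} :: ('a banach_copy \<times> 'a banach_copy) filter)"
definition "open U = (\<forall>x\<in>U. eventually (\<lambda>(x', y). x' = x \<longrightarrow> y \<in> U) (uniformity :: ('a banach_copy \<times> 'a banach_copy) filter))"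

lemmas banach_copy_defs = zero_banach_copy_def plus_banach_copy_def minus_banach_copy_def
  uminus_banach_copy_def scaleR_banach_copy_def norm_banach_copy_def

instance
proof
  fix x y :: "'a banach_copy"
  show "norm x = 0 \<longleftrightarrow> x = 0"
    by (metis norm_banach_copy_def norm_eq_zero of_copy_inverse to_copy_inverse UNIV_I zero_banach_copy_def)
qed (simp_all add: banach_copy_defs to_copy_inverse of_copy_inverse algebra_simps scaleR_add_right
      scaleR_add_left norm_triangle_ineq
      sgn_banach_copy_def dist_banach_copy_def uniformity_banach_copy_def open_banach_copy_def)

end

lemma bounded_linear_of_copy: "bounded_linear of_copy"
  by (rule bounded_linear_intro[where K = 1]) (simp_all add: banach_copy_defs to_copy_inverse)

lemma bounded_linear_to_copy: "bounded_linear to_copy"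
  by (rule bounded_linear_intro[where K = 1]) (simp_all add: banach_copy_defs to_copy_inverse)

lemma norm_of_copy [simp]: "norm (of_copy x) = norm x"
  by (simp add: norm_banach_copy_def)

lemma norm_to_copy [simp]: "norm (to_copy x) = norm x"
  by (simp add: norm_banach_copy_def to_copy_inverse)

instance banach_copy :: ("{real_normed_vector,complete_space}") banach
proof
  fix X :: "nat \<Rightarrow> 'a banach_copy"
  assume "Cauchy X"
  then have "Cauchy (\<lambda>n. of_copy (X n))"
    by (rule bounded_linear.Cauchy[OF bounded_linear_of_copy])
  then obtain L where "(\<lambda>n. of_copy (X n)) \<longlonglongrightarrow> L"
    using Cauchy_convergent convergent_def by blast
  then have "(\<lambda>n. to_copy (of_copy (X n))) \<longlonglongrightarrow> to_copy L"
    by (rule bounded_linear.tendsto[OF bounded_linear_to_copy])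
  then show "convergent X"
    by (auto simp: of_copy_inverse convergent_def)
qed

text \<open>
  The following facts are the classical ones for Banach spaces, carried over along the isometry
  \<open>to_copy\<close>.
\<close>

lemma has_integral_of_copy:
  fixes f :: "real \<Rightarrow> 'a::{real_normed_vector,complete_space}"
  shows "((\<lambda>s. to_copy (f s)) has_integral y) X \<Longrightarrow> (f has_integral of_copy y) X"
  using has_integral_linear[OF _ bounded_linear_of_copy, of "\<lambda>s. to_copy (f s)"]
  by (simp add: o_def to_copy_inverse)

lemma integrable_continuous:
  fixes f :: "real \<Rightarrow> 'a::{real_normed_vector,complete_space}"
  assumes "continuous_on {a..b} f"
  shows "f integrable_on {a..b}"
proof -
  have "continuous_on {a..b} (\<lambda>s. to_copy (f s))"
    using assms by (rule bounded_linear.continuous_on[OF bounded_linear_to_copy])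
  then have "(\<lambda>s. to_copy (f s)) integrable_on {a..b}"
    by (rule integrable_continuous_real)
  then show ?thesis
    unfolding integrable_on_def using has_integral_of_copy by blast
qed

lemma integral_of_copy:
  fixes f :: "real \<Rightarrow> 'a::{real_normed_vector,complete_space}"
  assumes "continuous_on {a..b} f"
  shows "integral {a..b} f = of_copy (integral {a..b} (\<lambda>s. to_copy (f s)))"
proof -
  have "continuous_on {a..b} (\<lambda>s. to_copy (f s))"
    using assms by (rule bounded_linear.continuous_on[OF bounded_linear_to_copy])
  then have "((\<lambda>s. to_copy (f s)) has_integral integral {a..b} (\<lambda>s. to_copy (f s))) {a..b}"
    by (intro integrable_integral integrable_continuous_real)
  from has_integral_of_copy[OF this] show ?thesis by (rule integral_unique)
qed

lemma integral_has_derivative: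
  fixes f :: "real \<Rightarrow> 'a::{real_normed_vector,complete_space}"
  assumes "continuous_on {a..b} f" "x \<in> {a..b}"
  shows "((\<lambda>r. integral {a..r} f) has_vector_derivative f x) (at x within {a..b})"
proof -
  have c: "continuous_on {a..b} (\<lambda>s. to_copy (f s))"
    using assms(1) by (rule bounded_linear.continuous_on[OF bounded_linear_to_copy])
  have "((\<lambda>r. of_copy (integral {a..r} (\<lambda>s. to_copy (f s)))) has_vector_derivative
      of_copy (to_copy (f x))) (at x within {a..b})"
    using integral_has_vector_derivative[OF c assms(2)]
    by (rule bounded_linear.has_vector_derivative[OF bounded_linear_of_copy])
  then have "((\<lambda>r. of_copy (integral {a..r} (\<lambda>s. to_copy (f s)))) has_vector_derivative f x)
      (at x within {a..b})"
    by (simp add: to_copy_inverse)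
  then show ?thesis
  proof (rule has_vector_derivative_transform[rotated 2])
    show "x \<in> {a..b}" by (rule assms(2))
    fix r assume "r \<in> {a..b}"
    then show "integral {a..r} f = of_copy (integral {a..r} (\<lambda>s. to_copy (f s)))"
      by (intro integral_of_copy continuous_on_subset[OF assms(1)]) auto
  qed
qed

lemma integral_continuous_on_parameter:
  fixes f :: "real \<Rightarrow> real \<Rightarrow> 'a::{real_normed_vector,complete_space}"
  assumes "continuous_on (U \<times> {a..b}) (\<lambda>(x, s). f x s)"
  shows "continuous_on U (\<lambda>x. integral {a..b} (f x))"
proof -
  have c: "continuous_on (U \<times> cbox a b) (\<lambda>(x, s). to_copy (f x s))"
    using bounded_linear.continuous_on[OF bounded_linear_to_copy assms]
    by (simp add: case_prod_unfold)
  have "continuous_on U (\<lambda>x. of_copy (integral (cbox a b) (\<lambda>s. to_copy (f x s))))"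
    by (rule bounded_linear.continuous_on[OF bounded_linear_of_copy
        integral_continuous_on_param[OF c]])
  moreover have "integral {a..b} (f x) = of_copy (integral {a..b} (\<lambda>s. to_copy (f x s)))"
    if "x \<in> U" for x
  proof (rule integral_of_copy)
    have "continuous_on {a..b} ((\<lambda>(x, s). f x s) \<circ> (\<lambda>s. (x, s)))"
      using that by (intro continuous_on_compose continuous_intros continuous_on_subset[OF assms]) auto
    then show "continuous_on {a..b} (f x)" by (simp add: o_def)
  qed
  ultimately show ?thesis by (simp cong: continuous_on_cong)
qed

lemma summable_of_norm_le:
  fixes f :: "nat \<Rightarrow> 'a::{real_normed_vector,complete_space}"
  assumes "summable h" "\<And>n. norm (f n) \<le> h n"
  shows "summable f"
proof -
  have "summable (\<lambda>n. to_copy (f n))"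
    by (rule summable_comparison_test'[OF assms(1)]) (simp add: assms(2))
  from bounded_linear.summable[OF bounded_linear_of_copy this]
  show ?thesis by (simp add: to_copy_inverse)
qed

lemma suminf_norm_le:
  fixes f :: "nat \<Rightarrow> 'a::{real_normed_vector,complete_space}"
  assumes "summable h" "\<And>n. norm (f n) \<le> h n"
  shows "norm (suminf f) \<le> suminf h"
proof (rule tendsto_le[OF trivial_limit_sequentially])
  show "(\<lambda>n. sum h {..<n}) \<longlonglongrightarrow> suminf h"
    using assms(1) by (rule summable_LIMSEQ)
  show "(\<lambda>n. norm (sum f {..<n})) \<longlonglongrightarrow> norm (suminf f)"
    by (intro tendsto_norm summable_LIMSEQ summable_of_norm_le[OF assms])
  show "\<forall>\<^sub>F n in sequentially. norm (sum f {..<n}) \<le> sum h {..<n}"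
    by (intro always_eventually allI sum_norm_le assms(2))
qed

lemma norm_integral_le:
  fixes f :: "real \<Rightarrow> 'a::{real_normed_vector,complete_space}"
  assumes f: "continuous_on {a..b} f" and "a \<le> b" and B: "\<And>s. s \<in> {a..b} \<Longrightarrow> norm (f s) \<le> B"
  shows "norm (integral {a..b} f) \<le> B * (b - a)"
proof -
  have "continuous_on {a..b} (\<lambda>s. to_copy (f s))"
    using f by (rule bounded_linear.continuous_on[OF bounded_linear_to_copy])
  then show ?thesis
    using integral_bound[of a b "\<lambda>s. to_copy (f s)" B] assms integral_of_copy[OF f] by simp
qed

section \<open>Convolution with the kernels\<close>

text \<open>
  For \<open>c > 0\<close> and \<open>t \<ge> 0\<close> this is the kernel \<open>g (c + 1) t\<close>. The value 1 for \<open>c = 0\<close> makes it continuous at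
  \<open>t = 0\<close>, where \<open>g 1\<close> vanishes.
\<close>

definition frac_power :: "real \<Rightarrow> real \<Rightarrow> real" where
  "frac_power c t = (if c = 0 then 1 else t powr c / Gamma (c + 1))"

text \<open>
  The inverse of the substitution \<open>\<rho> = (1 - s / t) powr \<beta>\<close>, which removes the singularity of the
  kernel \<open>g \<beta> (t - s)\<close>.
\<close>

definition warp :: "real \<Rightarrow> real \<Rightarrow> real \<Rightarrow> real" where
  "warp \<beta> t \<rho> = t * (1 - \<rho> powr (1 / \<beta>))"

lemma warp_mem:
  assumes "\<beta> > 0" "t \<ge> 0" "\<rho> \<in> {0..1}"
  shows "warp \<beta> t \<rho> \<in> {0..t}"
proof -
  have "\<rho> powr (1 / \<beta>) \<le> 1 powr (1 / \<beta>)"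
    using assms by (intro powr_mono2) auto
  then have "1 - \<rho> powr (1 / \<beta>) \<in> {0..1}" by auto
  then show ?thesis using assms(2) by (auto simp: warp_def intro: mult_left_le)
qed

lemma continuous_on_warp:
  assumes "\<beta> > 0"
  shows "continuous_on (X \<times> {0..1}) (\<lambda>(t, \<rho>). warp \<beta> t \<rho>)"
  unfolding warp_def case_prod_unfold using assms
  by (intro continuous_intros continuous_on_powr') auto

lemma continuous_on_compose_warp:
  fixes u :: "real \<Rightarrow> 'a::real_normed_vector"
  assumes "\<beta> > 0" "T \<ge> 0" "continuous_on {0..T} u"
  shows "continuous_on ({0..T} \<times> {0..1}) (\<lambda>(t, \<rho>). u (warp \<beta> t \<rho>))"
proof -
  have "continuous_on ({0..T} \<times> {0..1}) (u \<circ> (\<lambda>(t, \<rho>). warp \<beta> t \<rho>))"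
  proof (rule continuous_on_compose[OF continuous_on_warp[OF assms(1)]], rule continuous_on_subset[OF assms(3)])
    show "(\<lambda>(t, \<rho>). warp \<beta> t \<rho>) ` ({0..T} \<times> {0..1}) \<subseteq> {0..T}"
      using warp_mem[OF assms(1)] by fastforce
  qed
  then show ?thesis by (simp add: o_def case_prod_unfold)
qed

lemma continuous_on_compose_warp1:
  fixes u :: "real \<Rightarrow> 'a::real_normed_vector"
  assumes "\<beta> > 0" "t \<ge> 0" "continuous_on {0..t} u"
  shows "continuous_on {0..1} (\<lambda>\<rho>. u (warp \<beta> t \<rho>))"
proof -
  have "continuous_on {0..1} ((\<lambda>(t, \<rho>). u (warp \<beta> t \<rho>)) \<circ> (\<lambda>\<rho>. (t, \<rho>)))"
    using assms(2) by (intro continuous_on_compose continuous_intros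
      continuous_on_subset[OF continuous_on_compose_warp[OF assms]]) auto
  then show ?thesis by (simp add: o_def)
qed

text \<open>
  The integrand \<open>g \<beta> (t - s) *\<^sub>R u s\<close> may be unbounded at \<open>s = t\<close>, but it has an explicit antiderivative \<open>F\<close>,
  continuous up to the end points, obtained by substituting \<open>\<rho> = (1 - s / t) powr \<beta>\<close>. The
  right-hand side is an integral of a continuous function over a fixed interval, from which
  integrability, norm bounds and continuity of the convolution in \<open>t\<close> can be read off.
\<close>

lemma conv_has_integral_warp:
  fixes u :: "real \<Rightarrow> 'a::{real_normed_vector,complete_space}"
  assumes \<beta>: "\<beta> > 0" and t: "t \<ge> 0" and u: "continuous_on {0..t} u"
  shows "((\<lambda>s. g \<beta> (t - s) *\<^sub>R u s) has_integral
    frac_power \<beta> t *\<^sub>R integral {0..1} (\<lambda>\<rho>. u (warp \<beta> t \<rho>))) {0..t}"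
proof (cases "t = 0")
  case True
  then show ?thesis using \<beta> by (simp add: frac_power_def has_integral_refl)
next
  case False
  with t have t: "t > 0" by simp
  define f where "f \<rho> = u (warp \<beta> t \<rho>)" for \<rho>
  define q where "q s = (1 - s / t) powr \<beta>" for s
  define F where "F s = - (frac_power \<beta> t *\<^sub>R integral {0..q s} f)" for s
  have q: "q s \<in> {0..1}" if "s \<in> {0..t}" for s
  proof -
    have "q s \<le> 1 powr \<beta>" unfolding q_def using that t \<beta> by (intro powr_mono2) auto
    then show ?thesis by (simp add: q_def)
  qed
  have cf: "continuous_on {0..1} f"
    unfolding f_def using t u \<beta> by (intro continuous_on_compose_warp1) auto
  have \<Phi>: "((\<lambda>r. integral {0..r} f) has_vector_derivative f x) (at x within {0..1})"
    if "x \<in> {0..1}" for x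
    using cf that by (rule integral_has_derivative)
  have c\<Phi>: "continuous_on {0..1} (\<lambda>r. integral {0..r} f)"
    using \<Phi> has_vector_derivative_continuous continuous_on_eq_continuous_within by blast
  have cq: "continuous_on {0..t} q"
    unfolding q_def using t \<beta> by (intro continuous_on_powr' continuous_intros) auto
  have "continuous_on {0..t} F"
  proof -
    have "continuous_on {0..t} ((\<lambda>r. integral {0..r} f) \<circ> q)"
      using q by (intro continuous_on_compose cq continuous_on_subset[OF c\<Phi>]) auto
    then show ?thesis unfolding F_def o_def by (intro continuous_intros)
  qed
  moreover have "(F has_vector_derivative g \<beta> (t - s) *\<^sub>R u s) (at s)" if s: "s \<in> {0<..<t}" for s
  proof -
    have s1: "0 < 1 - s / t" "1 - s / t < 1" using s t by (auto simp: field_simps)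
    then have "q s < 1 powr \<beta>" unfolding q_def using \<beta> by (intro powr_less_mono2) auto
    then have qs: "q s \<in> {0<..<1}" using s s1 t by (simp add: q_def)
    then have d1: "((\<lambda>r. integral {0..r} f) has_vector_derivative f (q s)) (at (q s))"
      using \<Phi>[of "q s"] at_within_Icc_at[of 0 "q s" 1] by auto
    have "(q has_real_derivative \<beta> * (1 - s / t) powr (\<beta> - 1) * (- (1 / t))) (at s)"
      unfolding q_def using s1 t by (auto intro!: derivative_eq_intros simp: field_simps)
    then have "(q has_vector_derivative \<beta> * (1 - s / t) powr (\<beta> - 1) * (- (1 / t))) (at s)"
      by (simp add: has_real_derivative_iff_has_vector_derivative)
    from vector_diff_chain_at[OF this d1]
    have "(F has_vector_derivative - (frac_power \<beta> t *\<^sub>R ((\<beta> * (1 - s / t) powr (\<beta> - 1) * (- (1 / t))) *\<^sub>R f (q s)))) (at s)"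
      unfolding F_def o_def
      by (intro has_vector_derivative_minus bounded_linear.has_vector_derivative[OF bounded_linear_scaleR_right])
    moreover have "f (q s) = u s"
    proof -
      have "q s powr (1 / \<beta>) = 1 - s / t"
        using s1 \<beta> by (simp add: q_def powr_powr)
      then show ?thesis using t by (simp add: f_def warp_def)
    qed
    moreover have "frac_power \<beta> t * (\<beta> * (1 - s / t) powr (\<beta> - 1) * (1 / t)) = g \<beta> (t - s)"
    proof -
      have "1 - s / t = (t - s) / t" using t by (simp add: field_simps)
      then have "(1 - s / t) powr (\<beta> - 1) = (t - s) powr (\<beta> - 1) / t powr (\<beta> - 1)"
        using s t by (simp add: powr_divide)
      moreover have "t powr \<beta> = t * t powr (\<beta> - 1)"
        using t by (simp add: powr_diff)
      moreover have "Gamma (\<beta> + 1) = \<beta> * Gamma \<beta>"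
        using \<beta> by (subst Gamma_plus1) (auto simp: nonpos_Ints_def)
      ultimately show ?thesis using s t \<beta> Gamma_real_pos[of \<beta>] by (simp add: frac_power_def g_def)
    qed
    ultimately show ?thesis by (simp add: algebra_simps)
  qed
  ultimately have "((\<lambda>s. g \<beta> (t - s) *\<^sub>R u s) has_integral (F t - F 0)) {0..t}"
    using t by (intro fundamental_theorem_of_calculus_interior) auto
  moreover have "q t = 0" "q 0 = 1" using t \<beta> by (auto simp: q_def)
  then have "F t - F 0 = frac_power \<beta> t *\<^sub>R integral {0..1} f" by (simp add: F_def)
  ultimately show ?thesis by (simp add: f_def[abs_def])
qed

lemma conv_warp:
  fixes u :: "real \<Rightarrow> 'a::{real_normed_vector,complete_space}"
  assumes "\<beta> > 0" "t \<ge> 0" "continuous_on {0..t} u"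
  shows "conv (g \<beta>) u t = frac_power \<beta> t *\<^sub>R integral {0..1} (\<lambda>\<rho>. u (warp \<beta> t \<rho>))"
  unfolding conv_def by (rule integral_unique[OF conv_has_integral_warp[OF assms]])

lemma conv_has_integral:
  fixes u :: "real \<Rightarrow> 'a::{real_normed_vector,complete_space}"
  assumes "\<beta> > 0" "t \<ge> 0" "continuous_on {0..t} u"
  shows "((\<lambda>s. g \<beta> (t - s) *\<^sub>R u s) has_integral conv (g \<beta>) u t) {0..t}"
  using conv_has_integral_warp[OF assms] by (simp add: conv_warp[OF assms])

lemma continuous_on_frac_power: "c \<ge> 0 \<Longrightarrow> continuous_on {0..} (frac_power c)"
  unfolding frac_power_def by (cases "c = 0") (auto intro!: continuous_intros continuous_on_powr' simp: Gamma_eq_zero_iff nonpos_Ints_def)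

lemma frac_power_nonneg: "c \<ge> 0 \<Longrightarrow> frac_power c t \<ge> 0"
  by (auto simp: frac_power_def Gamma_real_pos less_imp_le)

lemma frac_power_mono: "c \<ge> 0 \<Longrightarrow> 0 \<le> s \<Longrightarrow> s \<le> t \<Longrightarrow> frac_power c s \<le> frac_power c t"
  by (auto simp: frac_power_def intro!: divide_right_mono powr_mono2 Gamma_real_nonneg)

lemma continuous_on_conv:
  fixes u :: "real \<Rightarrow> 'a::{real_normed_vector,complete_space}"
  assumes "\<beta> > 0" "continuous_on {0..T} u"
  shows "continuous_on {0..T} (conv (g \<beta>) u)"
proof (cases "T \<ge> 0")
  case True
  have "continuous_on {0..T} (\<lambda>t. frac_power \<beta> t *\<^sub>R integral {0..1} (\<lambda>\<rho>. u (warp \<beta> t \<rho>)))"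
    using assms True
    by (intro continuous_on_scaleR continuous_on_subset[OF continuous_on_frac_power]
        integral_continuous_on_parameter continuous_on_compose_warp) auto
  then show ?thesis
  proof (rule continuous_on_eq)
    fix t assume "t \<in> {0..T}"
    then show "frac_power \<beta> t *\<^sub>R integral {0..1} (\<lambda>\<rho>. u (warp \<beta> t \<rho>)) = conv (g \<beta>) u t"
      using assms by (intro sym[OF conv_warp] continuous_on_subset[OF assms(2)]) auto
  qed
qed auto

lemma conv_linear:
  fixes u :: "real \<Rightarrow> 'a::{real_normed_vector,complete_space}" and C :: "'a \<Rightarrow> 'b::{real_normed_vector}"
  assumes "bounded_linear C" "\<beta> > 0" "t \<ge> 0" "continuous_on {0..t} u"
  shows "conv (g \<beta>) (\<lambda>s. C (u s)) t = C (conv (g \<beta>) u t)"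
  using has_integral_linear[OF conv_has_integral[OF assms(2-4)] assms(1)]
  by (auto simp: conv_def o_def linear_cmul[OF bounded_linear.linear[OF assms(1)]] intro!: integral_unique)

lemma conv_add:
  fixes u v :: "real \<Rightarrow> 'a::{real_normed_vector,complete_space}"
  assumes "\<beta> > 0" "t \<ge> 0" "continuous_on {0..t} u" "continuous_on {0..t} v"
  shows "conv (g \<beta>) (\<lambda>s. u s + v s) t = conv (g \<beta>) u t + conv (g \<beta>) v t"
  using has_integral_add[OF conv_has_integral[OF assms(1-3)] conv_has_integral[OF assms(1,2,4)]]
  by (auto simp: conv_def scaleR_add_right intro!: integral_unique)

lemma conv_diff:
  fixes u v :: "real \<Rightarrow> 'a::{real_normed_vector,complete_space}"
  assumes "\<beta> > 0" "t \<ge> 0" "continuous_on {0..t} u" "continuous_on {0..t} v"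
  shows "conv (g \<beta>) (\<lambda>s. u s - v s) t = conv (g \<beta>) u t - conv (g \<beta>) v t"
  using has_integral_diff[OF conv_has_integral[OF assms(1-3)] conv_has_integral[OF assms(1,2,4)]]
  by (auto simp: conv_def scaleR_diff_right intro!: integral_unique)

lemma conv_const:
  fixes x :: "'a::{real_normed_vector,complete_space}"
  assumes "\<beta> > 0" "t \<ge> 0"
  shows "conv (g \<beta>) (\<lambda>_. x) t = frac_power \<beta> t *\<^sub>R x"
  using conv_warp[of \<beta> t "\<lambda>_. x"] assms by simp

lemma conv_cong:
  assumes "\<And>s. s \<in> {0..t} \<Longrightarrow> u s = v s"
  shows "conv a u t = conv a v t"
  unfolding conv_def using assms by (intro integral_cong) simp

lemma norm_conv_le:
  fixes u :: "real \<Rightarrow> 'a::{real_normed_vector,complete_space}"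
  assumes "\<beta> > 0" "t \<ge> 0" "continuous_on {0..t} u" "\<And>s. s \<in> {0..t} \<Longrightarrow> norm (u s) \<le> B"
  shows "norm (conv (g \<beta>) u t) \<le> B * frac_power \<beta> t"
proof -
  have "norm (integral {0..1} (\<lambda>\<rho>. u (warp \<beta> t \<rho>))) \<le> B * (1 - 0)"
    using assms warp_mem by (intro norm_integral_le continuous_on_compose_warp1) auto
  then have "frac_power \<beta> t * norm (integral {0..1} (\<lambda>\<rho>. u (warp \<beta> t \<rho>))) \<le> frac_power \<beta> t * B"
    using assms(1) by (intro mult_left_mono frac_power_nonneg) auto
  then show ?thesis
    using assms(1) by (simp add: conv_warp[OF assms(1-3)] frac_power_nonneg mult.commute[of B])
qed

lemma Gamma_real_nonzero: "c > 0 \<Longrightarrow> Gamma (c :: real) \<noteq> 0"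
  using Gamma_real_pos[of c] by linarith

text \<open>
  Euler's Beta integral, in the normalisation of the kernels.
\<close>

lemma conv_frac_power:
  assumes \<beta>: "\<beta> > 0" and c: "c \<ge> 0" and t: "t \<ge> 0"
  shows "conv (g \<beta>) (frac_power c) t = frac_power (\<beta> + c) t"
proof (cases "c = 0 \<or> t = 0")
  case True
  then show ?thesis
  proof
    assume "c = 0"
    then show ?thesis using conv_const[OF \<beta> t, of "1::real"] by (simp add: frac_power_def conv_def)
  next
    assume "t = 0"
    then show ?thesis using \<beta> c by (simp add: frac_power_def conv_def)
  qed
next
  case False
  with c t have c: "c > 0" and t: "t > 0" by auto
  have "((\<lambda>x. x powr (c + 1 - 1) * (1 - x) powr (\<beta> - 1)) has_integral Beta (c + 1) \<beta>) {0..1}"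
    using c \<beta> by (intro has_integral_Beta_real) auto
  moreover have "(\<lambda>x. x * t) ` {0..1} = {0..t}"
    using t image_mult_atLeastAtMost[of t 0 1] by (simp add: mult.commute)
  ultimately have "((\<lambda>s. (s / t) powr c * (1 - s / t) powr (\<beta> - 1)) has_integral t * Beta (c + 1) \<beta>) {0..t}"
    using has_integral_stretch_real[of "\<lambda>x. x powr c * (1 - x) powr (\<beta> - 1)" "Beta (c + 1) \<beta>" 0 1 "1 / t"] t
    by (simp add: mult.commute)
  from has_integral_mult_right[OF this, of "t powr (\<beta> + c - 1) / (Gamma \<beta> * Gamma (c + 1))"]
  have "((\<lambda>s. t powr (\<beta> + c - 1) / (Gamma \<beta> * Gamma (c + 1)) * ((s / t) powr c * (1 - s / t) powr (\<beta> - 1)))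
      has_integral t powr (\<beta> + c - 1) / (Gamma \<beta> * Gamma (c + 1)) * (t * Beta (c + 1) \<beta>)) {0..t}" .
  then have "((\<lambda>s. g \<beta> (t - s) *\<^sub>R frac_power c s)
      has_integral t powr (\<beta> + c - 1) / (Gamma \<beta> * Gamma (c + 1)) * (t * Beta (c + 1) \<beta>)) {0..t}"
  proof (rule has_integral_spike_finite[rotated 2, of _ _ _ "{t}"])
    fix s assume "s \<in> {0..t} - {t}"
    then have s: "0 \<le> s" "s < t" by auto
    have "1 - s / t = (t - s) / t" using t by (simp add: field_simps)
    then have "(1 - s / t) powr (\<beta> - 1) = (t - s) powr (\<beta> - 1) / t powr (\<beta> - 1)"
      using s t by (simp add: powr_divide)
    moreover have "(s / t) powr c = s powr c / t powr c"
      using s t by (simp add: powr_divide)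
    moreover have "t powr (\<beta> + c - 1) = t powr c * t powr (\<beta> - 1)"
      by (simp flip: powr_add add: algebra_simps)
    ultimately show "g \<beta> (t - s) *\<^sub>R frac_power c s = t powr (\<beta> + c - 1) / (Gamma \<beta> * Gamma (c + 1)) *
        ((s / t) powr c * (1 - s / t) powr (\<beta> - 1))"
      using s t c by (simp add: g_def frac_power_def)
  qed auto
  moreover have "t powr (\<beta> + c - 1) / (Gamma \<beta> * Gamma (c + 1)) * (t * Beta (c + 1) \<beta>) = frac_power (\<beta> + c) t"
  proof -
    have "t powr (\<beta> + c) = t * t powr (\<beta> + c - 1)" using t by (simp add: powr_diff)
    moreover have "Gamma \<beta> \<noteq> 0" "Gamma (c + 1) \<noteq> 0"
      using \<beta> c by (simp_all add: Gamma_real_nonzero)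
    ultimately show ?thesis using c \<beta> by (simp add: frac_power_def Beta_def add_ac)
  qed
  ultimately show ?thesis unfolding conv_def by (auto intro: integral_unique)
qed

lemma conv_g1:
  fixes u :: "real \<Rightarrow> 'a::real_normed_vector"
  shows "conv (g 1) u t = integral {0..t} u"
  unfolding conv_def by (rule integral_spike[of "{t}"]) (auto simp: g_def)

lemma power_eq_frac_power: "s \<ge> 0 \<Longrightarrow> s ^ k = fact k * frac_power (real k) s"
  by (cases "k = 0") (simp_all add: frac_power_def powr_realpow' Gamma_fact add.commute[of _ 1])

lemma conv_sum:
  fixes u :: "'i \<Rightarrow> real \<Rightarrow> 'a::{real_normed_vector,complete_space}"
  assumes "\<beta> > 0" "t \<ge> 0" "\<And>i. i \<in> I \<Longrightarrow> continuous_on {0..t} (u i)" "finite I"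
  shows "conv (g \<beta>) (\<lambda>s. \<Sum>i\<in>I. u i s) t = (\<Sum>i\<in>I. conv (g \<beta>) (u i) t)"
proof -
  have "((\<lambda>s. \<Sum>i\<in>I. g \<beta> (t - s) *\<^sub>R u i s) has_integral (\<Sum>i\<in>I. conv (g \<beta>) (u i) t)) {0..t}"
    using assms by (intro has_integral_sum conv_has_integral) auto
  then show ?thesis unfolding conv_def
    by (intro integral_unique) (simp add: scaleR_sum_right)
qed

lemma conv_conv_polynomial:
  assumes "a > 0" "b > 0" "t \<ge> 0" "real_polynomial_function (p :: real \<Rightarrow> real)"
  shows "conv (g a) (conv (g b) p) t = conv (g (a + b)) p t"
proof -
  obtain c n where p: "p = (\<lambda>s. \<Sum>k\<le>n. c k * s ^ k)"
    using assms(4) real_polynomial_function_iff_sum by blast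
  have ce: "continuous_on {0..t'} (frac_power (real k + d))" if "d \<ge> 0" for k d t'
    using that by (intro continuous_on_subset[OF continuous_on_frac_power]) auto
  have sum_frac_power: "conv (g b') (\<lambda>s. \<Sum>k\<le>n. c k * fact k * frac_power (real k + d) s) s =
      (\<Sum>k\<le>n. c k * fact k * frac_power (b' + (real k + d)) s)" if "b' > 0" "s \<ge> 0" "d \<ge> 0" for b' s d
  proof -
    have "conv (g b') (\<lambda>s. c k * fact k * frac_power (real k + d) s) s = c k * fact k * frac_power (b' + (real k + d)) s" for k
      using conv_linear[OF bounded_linear_mult_right, of b' s "frac_power (real k + d)" "c k * fact k"] that ce
      by (simp add: conv_frac_power)
    then show ?thesis using that ce by (subst conv_sum) (auto intro!: continuous_intros)
  qed
  have P: "conv (g b') p s = (\<Sum>k\<le>n. c k * fact k * frac_power (real k + b') s)" if "b' > 0" "s \<ge> 0" for b' s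
  proof -
    have "conv (g b') p s = conv (g b') (\<lambda>s. \<Sum>k\<le>n. c k * fact k * frac_power (real k) s) s"
      unfolding p by (intro conv_cong sum.cong) (auto simp: power_eq_frac_power)
    also have "\<dots> = (\<Sum>k\<le>n. c k * fact k * frac_power (real k + b') s)"
      using sum_frac_power[OF that, of 0] by (simp add: add.commute)
    finally show ?thesis .
  qed
  have "conv (g a) (conv (g b) p) t = conv (g a) (\<lambda>s. \<Sum>k\<le>n. c k * fact k * frac_power (real k + b) s) t"
    using assms by (intro conv_cong P) auto
  also have "\<dots> = conv (g (a + b)) p t"
    using assms by (subst sum_frac_power) (simp_all add: P add_ac)
  finally show ?thesis .
qed

text \<open>
  Both sides are continuous in \<open>f\<close> for the uniform norm on \<open>{0..t}\<close>, and agree on polynomials.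
\<close>

lemma conv_conv_real:
  fixes f :: "real \<Rightarrow> real"
  assumes a: "a > 0" and b: "b > 0" and t: "t \<ge> 0" and f: "continuous_on {0..t} f"
  shows "conv (g a) (conv (g b) f) t = conv (g (a + b)) f t"
proof -
  define C where "C = frac_power b t * frac_power a t + frac_power (a + b) t"
  have C: "C \<ge> 0" using a b by (simp add: C_def frac_power_nonneg)
  have "\<bar>conv (g a) (conv (g b) f) t - conv (g (a + b)) f t\<bar> \<le> \<epsilon>" if \<epsilon>: "\<epsilon> > 0" for \<epsilon>
  proof -
    define d where "d = \<epsilon> / (C + 1)"
    have d: "d > 0" "d * C \<le> \<epsilon>" using \<epsilon> C by (auto simp: d_def field_simps)
    obtain p where p: "real_polynomial_function p" "\<And>s. s \<in> {0..t} \<Longrightarrow> \<bar>f s - p s\<bar> < d"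
      using Stone_Weierstrass_real_polynomial_function[OF _ f d(1)] by auto
    have cp: "continuous_on X p" for X
      by (rule continuous_on_polymonial_function) (use p(1) real_polynomial_function_eq in auto)
    define h where "h s = f s - p s" for s
    have ch: "continuous_on {0..s} h" if "s \<le> t" for s
      unfolding h_def using that by (intro continuous_intros cp continuous_on_subset[OF f]) auto
    have h: "norm (h s) \<le> d" if "s \<in> {0..t}" for s
      using p(2)[OF that] by (simp add: h_def)
    have cc: "continuous_on {0..t} (conv (g b) h)" "continuous_on {0..t} (conv (g b) p)"
      using b ch cp by (auto intro!: continuous_on_conv)
    have fh: "f = (\<lambda>s. h s + p s)" by (simp add: h_def)
    have f1: "conv (g b') f s = conv (g b') h s + conv (g b') p s" if "b' > 0" "s \<in> {0..t}" for b' s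
      unfolding fh using that ch cp by (intro conv_add) auto
    have "conv (g a) (conv (g b) f) t = conv (g a) (\<lambda>s. conv (g b) h s + conv (g b) p s) t"
      using b by (intro conv_cong f1) auto
    also have "\<dots> = conv (g a) (conv (g b) h) t + conv (g a) (conv (g b) p) t"
      using a t by (intro conv_add cc)
    finally have "conv (g a) (conv (g b) f) t - conv (g (a + b)) f t =
        conv (g a) (conv (g b) h) t - conv (g (a + b)) h t"
      using a b t p(1) by (simp add: f1 conv_conv_polynomial)
    moreover have "norm (conv (g a) (conv (g b) h) t) \<le> d * frac_power b t * frac_power a t"
    proof (rule norm_conv_le[OF a t cc(1)])
      fix s assume s: "s \<in> {0..t}"
      then have "norm (conv (g b) h s) \<le> d * frac_power b s"
        using b ch h by (intro norm_conv_le) auto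
      also have "\<dots> \<le> d * frac_power b t" using s b d by (intro mult_left_mono frac_power_mono) auto
      finally show "norm (conv (g b) h s) \<le> d * frac_power b t" .
    qed
    moreover have "norm (conv (g (a + b)) h t) \<le> d * frac_power (a + b) t"
      using a b t ch h by (intro norm_conv_le) auto
    ultimately have "\<bar>conv (g a) (conv (g b) f) t - conv (g (a + b)) f t\<bar> \<le> d * C"
      by (simp add: C_def algebra_simps)
    then show ?thesis using d by simp
  qed
  then have "\<bar>conv (g a) (conv (g b) f) t - conv (g (a + b)) f t\<bar> \<le> 0"
    by (rule field_le_epsilon) simp
  then show ?thesis by simp
qed

text \<open>
  Convolution commutes with bounded linear functionals, and vectors are separated by inner products.
\<close>

theorem conv_conv:
  fixes f :: "real \<Rightarrow> 'a::{real_inner,complete_space}"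
  assumes a: "a > 0" and b: "b > 0" and t: "t \<ge> 0" and f: "continuous_on {0..t} f"
  shows "conv (g a) (conv (g b) f) t = conv (g (a + b)) f t"
proof -
  have "conv (g a) (conv (g b) f) t \<bullet> z = conv (g (a + b)) f t \<bullet> z" for z
  proof -
    have lin: "bounded_linear (\<lambda>x. x \<bullet> z)" by (rule bounded_linear_inner_left)
    have "conv (g a) (conv (g b) f) t \<bullet> z = conv (g a) (\<lambda>s. conv (g b) f s \<bullet> z) t"
      using conv_linear[OF lin a t continuous_on_conv[OF b f]] by simp
    also have "\<dots> = conv (g a) (conv (g b) (\<lambda>s. f s \<bullet> z)) t"
      using b by (intro conv_cong sym[OF conv_linear[OF lin]] continuous_on_subset[OF f]) auto
    also have "\<dots> = conv (g (a + b)) (\<lambda>s. f s \<bullet> z) t"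
      using a b t f by (intro conv_conv_real continuous_intros)
    also have "\<dots> = conv (g (a + b)) f t \<bullet> z"
      using a b by (intro conv_linear[OF lin _ t f]) simp
    finally show ?thesis .
  qed
  then show ?thesis by (metis vector_eq_rdot)
qed

lemma conv_tendsto:
  fixes u :: "nat \<Rightarrow> real \<Rightarrow> 'a::{real_normed_vector,complete_space}"
  assumes \<beta>: "\<beta> > 0" and t: "t \<ge> 0" and u: "\<And>n. continuous_on {0..t} (u n)"
    and lim: "uniform_limit {0..t} u v sequentially"
  shows "(\<lambda>n. conv (g \<beta>) (u n) t) \<longlonglongrightarrow> conv (g \<beta>) v t"
proof (rule tendstoI)
  fix \<epsilon> :: real assume \<epsilon>: "\<epsilon> > 0"
  have v: "continuous_on {0..t} v"
    by (rule uniform_limit_theorem[OF _ lim]) (auto simp: u)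
  define d where "d = \<epsilon> / (frac_power \<beta> t + 1)"
  have e: "frac_power \<beta> t \<ge> 0" using \<beta> by (simp add: frac_power_nonneg)
  then have d: "d > 0" "d * frac_power \<beta> t < \<epsilon>" using \<epsilon> by (auto simp: d_def field_simps)
  show "\<forall>\<^sub>F n in sequentially. dist (conv (g \<beta>) (u n) t) (conv (g \<beta>) v t) < \<epsilon>"
  proof (rule eventually_mono[OF uniform_limitD[OF lim d(1)]])
    fix n assume n: "\<forall>s\<in>{0..t}. dist (u n s) (v s) < d"
    have "norm (conv (g \<beta>) (\<lambda>s. u n s - v s) t) \<le> d * frac_power \<beta> t"
      using n by (intro norm_conv_le \<beta> t continuous_intros u v) (auto simp: dist_norm less_imp_le)
    then show "dist (conv (g \<beta>) (u n) t) (conv (g \<beta>) v t) < \<epsilon>"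
      using d by (simp add: dist_norm conv_diff[OF \<beta> t u v])
  qed
qed

text \<open>
  Transfers local statements between compact intervals and the half line.
\<close>

lemma at_within_half_line:
  fixes t :: real
  assumes "0 \<le> t" shows "at t within {0..} = at t within {0..t + 1}"
  by (rule at_within_nhd[of _ "{..<t + 1}"]) auto

lemma continuous_on_half_line:
  assumes "\<And>T. T \<ge> 0 \<Longrightarrow> continuous_on {0..T} f"
  shows "continuous_on {0::real..} f"
  unfolding continuous_on_eq_continuous_within
proof
  fix t :: real assume "t \<in> {0..}"
  then show "continuous (at t within {0..}) f"
    using assms[of "t + 1"] by (auto simp: at_within_half_line continuous_on_eq_continuous_within)
qed

lemma integral_has_derivative_half_line:
  fixes f :: "real \<Rightarrow> 'a::{real_normed_vector,complete_space}"
  assumes "continuous_on {0..} f" "t \<ge> 0"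
  shows "((\<lambda>r. integral {0..r} f) has_vector_derivative f t) (at t within {0..})"
  unfolding at_within_half_line[OF assms(2)]
  using assms by (intro integral_has_derivative continuous_on_subset[OF assms(1)]) auto

text \<open>
  Convolving \<open>v - x = g \<alpha> * f\<close> with \<open>g (1 - \<alpha>)\<close> turns the right-hand side into \<open>g 1 * f\<close>, the integral of \<open>f\<close>.
\<close>

lemma caputo_derivative_of_integral_equation:
  fixes v :: "real \<Rightarrow> 'a::{real_inner,complete_space}"
  assumes \<alpha>: "0 < \<alpha>" "\<alpha> < 1" and f: "continuous_on {0..} f"
    and v: "\<And>t. t \<ge> 0 \<Longrightarrow> v t = x + conv (g \<alpha>) f t" and t: "t \<ge> 0"
  shows "(conv (g (1 - \<alpha>)) (\<lambda>s. v s - x) has_vector_derivative f t) (at t within {0..})"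
proof (rule has_vector_derivative_transform[OF _ _ integral_has_derivative_half_line[OF f t]])
  fix r :: real assume "r \<in> {0..}"
  then have r: "r \<ge> 0" by simp
  have "conv (g (1 - \<alpha>)) (\<lambda>s. v s - x) r = conv (g (1 - \<alpha>)) (conv (g \<alpha>) f) r"
    by (rule conv_cong) (simp add: v)
  also have "\<dots> = conv (g (1 - \<alpha> + \<alpha>)) f r"
    using \<alpha> r by (intro conv_conv continuous_on_subset[OF f]) auto
  finally show "conv (g (1 - \<alpha>)) (\<lambda>s. v s - x) r = integral {0..r} f"
    by (simp add: conv_g1)
qed (use t in auto)

section \<open>The energy inequality at a maximum of the norm\<close>

text \<open>
  The function \<open>p\<close> is nonnegative and vanishes at \<open>\<tau>\<close>. Compare \<open>g \<beta> * p\<close> at \<open>\<tau>\<close> and at an earlier time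
  \<open>s\<close>: on \<open>{0..s}\<close> the kernel with the larger argument is the smaller one, so the only positive
  contribution comes from \<open>{s..\<tau>}\<close>. There \<open>p \<le> L (\<tau> - s)\<close>, and the contribution is
  \<open>O((\<tau> - s) powr (1 + \<beta>))\<close>, which is negligible against \<open>\<tau> - s\<close>.
\<close>

lemma left_derivative_conv_nonpos:
  assumes \<beta>: "0 < \<beta>" "\<beta> < 1" and \<tau>: "\<tau> > 0" and p: "continuous_on {0..\<tau>} p"
    and pos: "\<And>s. s \<in> {0..\<tau>} \<Longrightarrow> p s \<ge> 0"
    and lip: "\<And>s. s \<in> {\<tau>/2..\<tau>} \<Longrightarrow> p s \<le> L * (\<tau> - s)"
    and d: "(conv (g \<beta>) p has_real_derivative d) (at \<tau> within {0..\<tau>})"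
  shows "d \<le> 0"
proof -
  have L: "L \<ge> 0"
  proof -
    have "p (\<tau>/2) \<le> L * (\<tau> - \<tau>/2)" "0 \<le> p (\<tau>/2)"
      using lip[of "\<tau>/2"] pos[of "\<tau>/2"] \<tau> by auto
    then have "0 \<le> L * (\<tau> - \<tau>/2)" by linarith
    then show ?thesis using \<tau> by (simp add: zero_le_mult_iff)
  qed
  have incr: "conv (g \<beta>) p \<tau> - conv (g \<beta>) p s \<le> L * (\<tau> - s) * frac_power \<beta> (\<tau> - s)"
    if s: "s \<in> {\<tau>/2..<\<tau>}" for s
  proof -
    have s': "0 < s" "s < \<tau>" using s \<tau> by auto
    have i: "((\<lambda>r. g \<beta> (\<tau> - r) * p r) has_integral conv (g \<beta>) p \<tau>) {0..\<tau>}"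
      using conv_has_integral[OF \<beta>(1) _ p] \<tau> by simp
    then have i1: "(\<lambda>r. g \<beta> (\<tau> - r) * p r) integrable_on {0..s}" "(\<lambda>r. g \<beta> (\<tau> - r) * p r) integrable_on {s..\<tau>}"
      using s' by (auto intro!: integrable_on_subinterval[OF has_integral_integrable[OF i]])
    have c: "conv (g \<beta>) p \<tau> = integral {0..s} (\<lambda>r. g \<beta> (\<tau> - r) * p r) + integral {s..\<tau>} (\<lambda>r. g \<beta> (\<tau> - r) * p r)"
      using Henstock_Kurzweil_Integration.integral_combine[of 0 s \<tau> "\<lambda>r. g \<beta> (\<tau> - r) * p r"] s' i
      by (auto simp: has_integral_iff)
    have i2: "((\<lambda>r. g \<beta> (s - r) * p r) has_integral conv (g \<beta>) p s) {0..s}"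
      using conv_has_integral[OF \<beta>(1) _ continuous_on_subset[OF p], of s] s' by simp
    have "integral {0..s} (\<lambda>r. g \<beta> (\<tau> - r) * p r) \<le> conv (g \<beta>) p s"
    proof (rule has_integral_le[OF integrable_integral[OF i1(1)] has_integral_spike_finite[OF _ _ i2, of "{s}"]])
      fix r assume r: "r \<in> {0..s}"
      show "g \<beta> (\<tau> - r) * p r \<le> (if r = s then g \<beta> (\<tau> - s) * p s else g \<beta> (s - r) * p r)"
      proof (cases "r = s")
        case False
        with r have "(\<tau> - r) powr (\<beta> - 1) \<le> (s - r) powr (\<beta> - 1)"
          using s' \<beta> by (intro powr_mono2') auto
        then show ?thesis using False r s' pos[of r] \<beta>
          by (auto simp: g_def intro!: mult_right_mono divide_right_mono Gamma_real_nonneg)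
      qed simp
    qed auto
    moreover have "integral {s..\<tau>} (\<lambda>r. g \<beta> (\<tau> - r) * p r) \<le> L * (\<tau> - s) * frac_power \<beta> (\<tau> - s)"
    proof -
      have "((\<lambda>r. g \<beta> (\<tau> - s - r) *\<^sub>R (1::real)) has_integral frac_power \<beta> (\<tau> - s)) {0..\<tau> - s}"
        using conv_has_integral[OF \<beta>(1), of "\<tau> - s" "\<lambda>_. 1::real"] conv_const[OF \<beta>(1), of "\<tau> - s" "1::real"] s'
        by simp
      from has_integral_affinity'[of _ _ 0 "\<tau> - s" 1 "-s", simplified, OF this]
      have "((\<lambda>r. g \<beta> (\<tau> - r)) has_integral frac_power \<beta> (\<tau> - s)) {s..\<tau>}" by simp
      from has_integral_mult_right[OF this, of "L * (\<tau> - s)"]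
      show ?thesis
      proof (rule has_integral_le[OF integrable_integral[OF i1(2)]])
        fix r assume r: "r \<in> {s..\<tau>}"
        then have "p r \<le> L * (\<tau> - r)" using s by (intro lip) auto
        also have "\<dots> \<le> L * (\<tau> - s)" using r L by (intro mult_left_mono) auto
        finally have "p r \<le> L * (\<tau> - s)" .
        moreover have "g \<beta> (\<tau> - r) \<ge> 0" using \<beta> by (auto simp: g_def Gamma_real_nonneg)
        ultimately show "g \<beta> (\<tau> - r) * p r \<le> L * (\<tau> - s) * g \<beta> (\<tau> - r)"
          by (metis mult.commute mult_right_mono)
      qed
    qed
    ultimately show ?thesis using c by simp
  qed
  have "((\<lambda>s. (conv (g \<beta>) p s - conv (g \<beta>) p \<tau>) / (s - \<tau>)) \<longlongrightarrow> d) (at \<tau> within {0..\<tau>})"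
    using d by (simp add: has_field_derivative_iff)
  then have lim1: "((\<lambda>s. (conv (g \<beta>) p s - conv (g \<beta>) p \<tau>) / (s - \<tau>)) \<longlongrightarrow> d) (at_left \<tau>)"
    using \<tau> by (simp add: at_within_Icc_at_left)
  have "continuous (at_left \<tau>) (\<lambda>s. L * frac_power \<beta> (\<tau> - s))"
  proof -
    have "continuous_on {..\<tau>} (frac_power \<beta> \<circ> (\<lambda>s. \<tau> - s))"
      using \<beta> by (intro continuous_on_compose continuous_intros continuous_on_subset[OF continuous_on_frac_power]) auto
    then have "continuous (at \<tau> within {..\<tau>}) (\<lambda>s. L * frac_power \<beta> (\<tau> - s))"
      by (intro continuous_intros) (simp add: o_def continuous_on_eq_continuous_within)
    then show ?thesis by (rule continuous_within_subset) auto
  qed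
  then have lim2: "((\<lambda>s. L * frac_power \<beta> (\<tau> - s)) \<longlongrightarrow> 0) (at_left \<tau>)"
    using \<beta> by (simp add: continuous_within frac_power_def)
  have "\<forall>\<^sub>F s in at_left \<tau>. (conv (g \<beta>) p s - conv (g \<beta>) p \<tau>) / (s - \<tau>) \<le> L * frac_power \<beta> (\<tau> - s)"
    using eventually_at_left_real[of "\<tau>/2" \<tau>]
  proof (rule eventually_mono)
    fix s assume s: "s \<in> {\<tau>/2<..<\<tau>}"
    then have "(conv (g \<beta>) p \<tau> - conv (g \<beta>) p s) / (\<tau> - s) \<le> L * frac_power \<beta> (\<tau> - s)"
      using incr[of s] by (simp add: divide_le_eq mult_ac)
    moreover have "(conv (g \<beta>) p s - conv (g \<beta>) p \<tau>) / (s - \<tau>) = (conv (g \<beta>) p \<tau> - conv (g \<beta>) p s) / (\<tau> - s)"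
      by (metis minus_diff_eq minus_divide_divide)
    ultimately show "(conv (g \<beta>) p s - conv (g \<beta>) p \<tau>) / (s - \<tau>) \<le> L * frac_power \<beta> (\<tau> - s)" by simp
  qed (use \<tau> in simp)
  from tendsto_le[OF _ lim2 lim1 this] show "d \<le> 0" by simp
qed

text \<open>
  Write \<open>(v s - x) \<bullet> v \<tau> = q - p s\<close> with \<open>q = (norm (v \<tau>))\<^sup>2 - x \<bullet> v \<tau>\<close> and \<open>p s = (v \<tau> - v s) \<bullet> v \<tau>\<close>. The constant
  \<open>q\<close> contributes \<open>q * g (1 - \<alpha>) \<tau>\<close> to the derivative, and \<open>p\<close> is nonnegative because \<open>norm (v s)\<close> is
  largest at \<open>\<tau>\<close>, so that \<open>left_derivative_conv_nonpos\<close> determines the sign of its contribution.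
\<close>

lemma energy_inequality:
  fixes v :: "real \<Rightarrow> 'a::{real_inner,complete_space}"
  assumes \<alpha>: "0 < \<alpha>" "\<alpha> < 1" and \<tau>: "\<tau> > 0" and v: "continuous_on {0..\<tau>} v"
    and max: "\<And>s. s \<in> {0..\<tau>} \<Longrightarrow> norm (v s) \<le> norm (v \<tau>)"
    and lip: "\<And>s. s \<in> {\<tau>/2..\<tau>} \<Longrightarrow> norm (v \<tau> - v s) \<le> L * (\<tau> - s)"
    and f: "(conv (g (1 - \<alpha>)) (\<lambda>s. v s - x) has_vector_derivative f) (at \<tau> within {0..\<tau>})"
  shows "g (1 - \<alpha>) \<tau> * ((norm (v \<tau>))\<^sup>2 - x \<bullet> v \<tau>) \<le> f \<bullet> v \<tau>"
proof -
  let ?k = "g (1 - \<alpha>)"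
  define q where "q = (norm (v \<tau>))\<^sup>2 - x \<bullet> v \<tau>"
  define p where "p s = (v \<tau> - v s) \<bullet> v \<tau>" for s
  have \<beta>: "0 < 1 - \<alpha>" "1 - \<alpha> < 1" using \<alpha> by auto
  have vs: "continuous_on {0..s} v" if "s \<le> \<tau>" for s
    using that by (intro continuous_on_subset[OF v]) auto
  have lin: "bounded_linear (\<lambda>y. y \<bullet> v \<tau>)" by (rule bounded_linear_inner_left)
  have p: "conv ?k p s = q * frac_power (1 - \<alpha>) s - conv ?k (\<lambda>s. v s - x) s \<bullet> v \<tau>" if s: "s \<in> {0..\<tau>}" for s
  proof -
    have "p = (\<lambda>s. q - (v s - x) \<bullet> v \<tau>)"
      by (simp add: p_def q_def power2_norm_eq_inner inner_diff_left fun_eq_iff)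
    then have "conv ?k p s = conv ?k (\<lambda>_. q) s - conv ?k (\<lambda>s. (v s - x) \<bullet> v \<tau>) s"
      using \<beta> s vs by (simp only:) (intro conv_diff continuous_intros, auto)
    also have "conv ?k (\<lambda>s. (v s - x) \<bullet> v \<tau>) s = conv ?k (\<lambda>s. v s - x) s \<bullet> v \<tau>"
      using \<beta> s vs by (intro conv_linear[OF lin] continuous_intros) auto
    finally show ?thesis using conv_const[OF \<beta>(1), of s q] s by simp
  qed
  have "(frac_power (1 - \<alpha>) has_real_derivative ?k \<tau>) (at \<tau> within {0..\<tau>})"
  proof -
    have G: "Gamma (1 - \<alpha> + 1) = (1 - \<alpha>) * Gamma (1 - \<alpha>)"
      using \<alpha> by (subst Gamma_plus1) (auto dest: nonpos_Ints_nonpos)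
    have "((\<lambda>s. s powr (1 - \<alpha>) / Gamma (1 - \<alpha> + 1)) has_real_derivative
        ((1 - \<alpha>) * \<tau> powr (1 - \<alpha> - 1)) / Gamma (1 - \<alpha> + 1)) (at \<tau>)"
      using \<tau> \<alpha> Gamma_real_nonzero[of "2 - \<alpha>"] by (auto intro!: derivative_eq_intros)
    moreover have "((1 - \<alpha>) * \<tau> powr (1 - \<alpha> - 1)) / Gamma (1 - \<alpha> + 1) = ?k \<tau>"
      unfolding G using \<tau> \<alpha> by (simp add: g_def)
    moreover have "frac_power (1 - \<alpha>) = (\<lambda>s. s powr (1 - \<alpha>) / Gamma (1 - \<alpha> + 1))"
      using \<alpha> by (simp add: frac_power_def fun_eq_iff)
    ultimately show ?thesis by (simp only: has_field_derivative_at_within)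
  qed
  moreover have "((\<lambda>s. conv ?k (\<lambda>s. v s - x) s \<bullet> v \<tau>) has_real_derivative f \<bullet> v \<tau>) (at \<tau> within {0..\<tau>})"
    using bounded_linear.has_vector_derivative[OF lin f]
    by (simp add: has_real_derivative_iff_has_vector_derivative)
  ultimately have "((\<lambda>s. q * frac_power (1 - \<alpha>) s - conv ?k (\<lambda>s. v s - x) s \<bullet> v \<tau>) has_real_derivative
      q * ?k \<tau> - f \<bullet> v \<tau>) (at \<tau> within {0..\<tau>})"
    by (auto intro!: derivative_eq_intros)
  then have d: "(conv ?k p has_real_derivative q * ?k \<tau> - f \<bullet> v \<tau>) (at \<tau> within {0..\<tau>})"
    by (rule has_field_derivative_transform_within[OF _ zero_less_one]) (use \<tau> p in auto)
  have "q * ?k \<tau> - f \<bullet> v \<tau> \<le> 0"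
  proof (rule left_derivative_conv_nonpos[OF \<beta> \<tau> _ _ _ d])
    show "continuous_on {0..\<tau>} p" unfolding p_def by (intro continuous_intros v)
  next
    fix s assume "s \<in> {0..\<tau>}"
    have "v s \<bullet> v \<tau> \<le> norm (v s) * norm (v \<tau>)" by (rule norm_cauchy_schwarz)
    also have "\<dots> \<le> norm (v \<tau>) * norm (v \<tau>)"
      using max[OF \<open>s \<in> {0..\<tau>}\<close>] by (intro mult_right_mono) auto
    finally show "p s \<ge> 0"
      by (simp add: p_def inner_diff_left power2_norm_eq_inner flip: power2_eq_square)
  next
    fix s assume s: "s \<in> {\<tau>/2..\<tau>}"
    have "p s \<le> norm (v \<tau> - v s) * norm (v \<tau>)"
      unfolding p_def by (rule norm_cauchy_schwarz)
    also have "\<dots> \<le> L * (\<tau> - s) * norm (v \<tau>)"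
      using lip[OF s] by (intro mult_right_mono) auto
    finally show "p s \<le> L * norm (v \<tau>) * (\<tau> - s)" by (simp add: mult_ac)
  qed
  then show ?thesis by (simp add: q_def mult.commute)
qed

lemma g_pos: "\<beta> > 0 \<Longrightarrow> t > 0 \<Longrightarrow> g \<beta> t > 0"
  by (simp add: g_def)

lemma attains_max_norm:
  fixes v :: "real \<Rightarrow> 'a::real_normed_vector"
  assumes "continuous_on {0..t} v" "t \<ge> 0"
  obtains \<tau> where "\<tau> \<in> {0..t}" "\<And>s. s \<in> {0..t} \<Longrightarrow> norm (v s) \<le> norm (v \<tau>)"
proof -
  have "\<exists>\<tau>\<in>{0..t}. \<forall>s\<in>{0..t}. norm (v s) \<le> norm (v \<tau>)"
    using assms by (intro continuous_attains_sup continuous_on_norm) auto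
  then show thesis using that by blast
qed

section \<open>The equation with a bounded operator: the Mittag-Leffler series\<close>

text \<open>
  Restrict Euler's integral for \<open>Gamma\<close> to \<open>{R..}\<close> and bound the power of \<open>t\<close> below by that of \<open>R\<close>. As \<open>R\<close> is
  free, \<open>Gamma (c + 1)\<close> outgrows every exponential in \<open>c\<close>.
\<close>

lemma Gamma_ge:
  fixes R c :: real
  assumes "R > 0" "c \<ge> 0"
  shows "R powr c * exp (- R) \<le> Gamma (c + 1)"
proof -
  have "((\<lambda>x::real. exp (- 1 * x)) has_integral exp (- 1 * R) / 1) {R..}"
    by (rule has_integral_exp_minus_to_infinity) simp
  from has_integral_mult_right[OF this, of "R powr c"]
  have "((\<lambda>x. R powr c * exp (- x)) has_integral R powr c * exp (- R)) {R..}" by simp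
  then have "((\<lambda>x. if x \<in> {R..} then R powr c * exp (- x) else 0) has_integral R powr c * exp (- R)) {0..}"
    using assms by (subst has_integral_restrict) auto
  moreover have "((\<lambda>t. t powr (c + 1 - 1) / exp t) has_integral Gamma (c + 1)) {0..}"
    using assms by (intro Gamma_integral_real) simp
  ultimately show ?thesis
    by (rule has_integral_le) (use assms in \<open>auto simp: exp_minus field_simps intro!: powr_mono2\<close>)
qed

lemma summable_frac_power:
  assumes \<alpha>: "\<alpha> > 0" and q: "q \<ge> 0" and T: "T \<ge> 0"
  shows "summable (\<lambda>k. q ^ k * frac_power (real k * \<alpha>) T)"
proof -
  \<comment> \<open>large enough for \<open>q (T / R)\<^bsup>\<alpha>\<^esup> \<le> 1/2\<close>, so that the terms are dominated by a geometric series\<close>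
  define R where "R = (T + 1) * (2 * q + 1) powr (1 / \<alpha>)"
  have R: "R > 0" using T q by (simp add: R_def)
  have "(T / R) powr \<alpha> \<le> 1 / (2 * q + 1)"
  proof -
    have "(T / R) powr \<alpha> = (T / (T + 1)) powr \<alpha> / (2 * q + 1)"
      using T q \<alpha> by (simp add: R_def powr_divide powr_mult powr_powr)
    moreover have "(T / (T + 1)) powr \<alpha> \<le> 1 powr \<alpha>"
      using T \<alpha> by (intro powr_mono2) auto
    ultimately show ?thesis using q by (simp add: divide_right_mono)
  qed
  then have "q * (T / R) powr \<alpha> \<le> q * (1 / (2 * q + 1))"
    using q by (rule mult_left_mono)
  also have "\<dots> \<le> 1 / 2" using q by (simp add: field_simps)
  finally have half: "q * (T / R) powr \<alpha> \<le> 1 / 2" .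
  have bound: "norm (q ^ k * frac_power (real k * \<alpha>) T) \<le> exp R * (1 / 2) ^ k" for k
  proof -
    have "frac_power (real k * \<alpha>) T \<le> exp R * ((T / R) powr \<alpha>) ^ k"
    proof (cases "k = 0")
      case False
      have "T powr (real k * \<alpha>) / Gamma (real k * \<alpha> + 1)
          \<le> T powr (real k * \<alpha>) / (R powr (real k * \<alpha>) * exp (- R))"
      proof (rule divide_left_mono)
        show le: "R powr (real k * \<alpha>) * exp (- R) \<le> Gamma (real k * \<alpha> + 1)"
          using \<alpha> by (intro Gamma_ge R) simp
        have "0 < R powr (real k * \<alpha>) * exp (- R)" using R by simp
        with le show "0 < Gamma (real k * \<alpha> + 1) * (R powr (real k * \<alpha>) * exp (- R))"
          by (rule_tac mult_pos_pos) linarith+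
      qed simp
      also have "\<dots> = exp R * (T / R) powr (real k * \<alpha>)"
        using R T by (simp add: powr_divide exp_minus field_simps)
      also have "(T / R) powr (real k * \<alpha>) = ((T / R) powr \<alpha>) ^ k"
        using False by (simp add: powr_powr mult.commute flip: powr_realpow')
      finally show ?thesis using False \<alpha> by (simp add: frac_power_def)
    qed (use R in \<open>simp add: frac_power_def\<close>)
    then have "q ^ k * frac_power (real k * \<alpha>) T \<le> q ^ k * (exp R * ((T / R) powr \<alpha>) ^ k)"
      using q by (intro mult_left_mono) auto
    also have "\<dots> = exp R * (q * (T / R) powr \<alpha>) ^ k" by (simp add: power_mult_distrib mult_ac)
    also have "\<dots> \<le> exp R * (1 / 2) ^ k"
      using half q by (intro mult_left_mono power_mono) auto
    finally show ?thesis using q \<alpha> by (simp add: frac_power_nonneg)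
  qed
  have "summable (\<lambda>k. exp R * (1 / 2 :: real) ^ k)"
    by (rule summable_mult[OF summable_geometric]) simp
  then show ?thesis by (rule summable_comparison_test'[OF _ bound])
qed

text \<open>
  Mean value theorem. The factor \<open>frac_power c t\<close> is kept on the right, so that the Lipschitz
  constants of the terms of the Mittag-Leffler series can be summed.
\<close>

lemma frac_power_left_lipschitz:
  assumes c: "c \<ge> 0" and t: "t > 0" and s: "s \<in> {t/2..t}"
  shows "\<bar>frac_power c t - frac_power c s\<bar> \<le> 2 * c / t * frac_power c t * (t - s)"
proof (cases "c = 0 \<or> s = t")
  case False
  with c s t have c: "c > 0" and s: "t/2 \<le> s" "s < t" "0 < s" by auto
  obtain z where z: "s < z" "z < t" "t powr c - s powr c = (t - s) * (c * z powr (c - 1))"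
    using s by (rule_tac MVT2[of s t "\<lambda>x. x powr c" "\<lambda>x. c * x powr (c - 1)", THEN exE])
      (auto intro!: derivative_eq_intros)
  have "z powr (c - 1) = z powr c / z" using z s by (simp add: powr_diff)
  also have "\<dots> \<le> t powr c / (t / 2)" using z s c t by (intro frac_le powr_mono2) auto
  finally have "t powr c - s powr c \<le> (t - s) * (c * (t powr c / (t / 2)))"
    unfolding z(3) using c s by (intro mult_left_mono) auto
  then have "(t powr c - s powr c) / Gamma (c + 1) \<le> (t - s) * (c * (t powr c / (t / 2))) / Gamma (c + 1)"
    using c by (intro divide_right_mono Gamma_real_nonneg) auto
  then have "frac_power c t - frac_power c s \<le> 2 * c / t * frac_power c t * (t - s)"
    using c by (simp add: frac_power_def diff_divide_distrib mult_ac)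
  then show ?thesis using frac_power_mono[of c s t] s c by simp
qed (auto simp: frac_power_def)

lemma uniform_limit_series:
  fixes f :: "nat \<Rightarrow> 's \<Rightarrow> 'a::{real_normed_vector,complete_space}"
  assumes h: "summable h" and f: "\<And>k t. t \<in> X \<Longrightarrow> norm (f k t) \<le> h k"
  shows "uniform_limit X (\<lambda>n t. \<Sum>k<n. f k t) (\<lambda>t. \<Sum>k. f k t) sequentially"
proof (rule uniform_limitI)
  fix \<epsilon> :: real assume "\<epsilon> > 0"
  have "(\<lambda>n. \<Sum>k. h (k + n)) \<longlonglongrightarrow> 0"
    by (rule suminf_exist_split2[OF h])
  then have "\<forall>\<^sub>F n in sequentially. (\<Sum>k. h (k + n)) < \<epsilon>"
    using \<open>\<epsilon> > 0\<close> by (rule order_tendstoD)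
  then show "\<forall>\<^sub>F n in sequentially. \<forall>t\<in>X. dist (\<Sum>k<n. f k t) (\<Sum>k. f k t) < \<epsilon>"
  proof (rule eventually_mono, intro ballI)
    fix n t assume n: "(\<Sum>k. h (k + n)) < \<epsilon>" and t: "t \<in> X"
    have "dist (\<Sum>k<n. f k t) (\<Sum>k. f k t) = norm ((\<Sum>k. f k t) - (\<Sum>k<n. f k t))"
      by (simp add: dist_commute dist_norm)
    also have "\<dots> = norm (\<Sum>k. f (k + n) t)"
      by (subst suminf_minus_initial_segment) (use summable_of_norm_le[OF h f[OF t]] in auto)
    also have "\<dots> \<le> (\<Sum>k. h (k + n))"
      using h f[OF t] by (intro suminf_norm_le) (auto simp: summable_iff_shift)
    finally show "dist (\<Sum>k<n. f k t) (\<Sum>k. f k t) < \<epsilon>" using n by simp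
  qed
qed

locale bounded_equation =
  fixes \<alpha> :: real and B :: "'a::{real_inner,complete_space} \<Rightarrow> 'a"
  assumes \<alpha>: "0 < \<alpha>" "\<alpha> < 1" and B: "bounded_linear B"
begin

text \<open>
  The operator \<open>E\<^sub>\<alpha>(t\<^bsup>\<alpha>\<^esup> B)\<close>, where \<open>E\<^sub>\<alpha>\<close> is the Mittag-Leffler function.
\<close>

definition mittag_leffler :: "real \<Rightarrow> 'a \<Rightarrow> 'a" where
  "mittag_leffler t x = (\<Sum>k. frac_power (real k * \<alpha>) t *\<^sub>R (B ^^ k) x)"

lemma norm_B_power: "norm ((B ^^ k) x) \<le> onorm B ^ k * norm x"
proof (induction k)
  case (Suc k)
  have "norm (B ((B ^^ k) x)) \<le> onorm B * norm ((B ^^ k) x)" by (rule onorm[OF B])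
  also have "\<dots> \<le> onorm B * (onorm B ^ k * norm x)"
    using Suc onorm_pos_le[OF B] by (rule mult_left_mono)
  finally show ?case by (simp add: mult_ac)
qed simp

lemma term_bound:
  assumes "t \<in> {0..T}"
  shows "norm (frac_power (real k * \<alpha>) t *\<^sub>R (B ^^ k) x) \<le> norm x * (onorm B ^ k * frac_power (real k * \<alpha>) T)"
proof -
  have "frac_power (real k * \<alpha>) t * norm ((B ^^ k) x) \<le> frac_power (real k * \<alpha>) T * (onorm B ^ k * norm x)"
    using assms \<alpha> onorm_pos_le[OF B] by (intro mult_mono frac_power_mono norm_B_power frac_power_nonneg) auto
  then show ?thesis using \<alpha> by (simp add: frac_power_nonneg mult_ac)
qed

lemma summable_bound: "T \<ge> 0 \<Longrightarrow> summable (\<lambda>k. norm x * (onorm B ^ k * frac_power (real k * \<alpha>) T))"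
  using \<alpha> onorm_pos_le[OF B] by (intro summable_mult summable_frac_power) auto

lemma summable_mittag_leffler: "t \<ge> 0 \<Longrightarrow> summable (\<lambda>k. frac_power (real k * \<alpha>) t *\<^sub>R (B ^^ k) x)"
  by (rule summable_of_norm_le[OF summable_bound term_bound]) auto

lemma uniform_limit_mittag_leffler:
  "T \<ge> 0 \<Longrightarrow> uniform_limit {0..T} (\<lambda>n t. \<Sum>k<n. frac_power (real k * \<alpha>) t *\<^sub>R (B ^^ k) x) (\<lambda>t. mittag_leffler t x) sequentially"
  unfolding mittag_leffler_def by (rule uniform_limit_series[OF summable_bound term_bound])

lemma continuous_on_partial_sum:
  "continuous_on {0..T} (\<lambda>t. \<Sum>k<n. frac_power (real k * \<alpha>) t *\<^sub>R (B ^^ k) x)"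
  using \<alpha> by (intro continuous_intros continuous_on_subset[OF continuous_on_frac_power]) auto

lemma continuous_on_mittag_leffler: "continuous_on {0..} (\<lambda>t. mittag_leffler t x)"
proof (rule continuous_on_half_line)
  fix T :: real assume "T \<ge> 0"
  then show "continuous_on {0..T} (\<lambda>t. mittag_leffler t x)"
    by (intro uniform_limit_theorem[OF _ uniform_limit_mittag_leffler] always_eventually allI continuous_on_partial_sum) auto
qed

lemma continuous_on_B_mittag_leffler: "continuous_on {0..} (\<lambda>t. B (mittag_leffler t x))"
  by (rule bounded_linear.continuous_on[OF B continuous_on_mittag_leffler])

text \<open>
  By \<open>conv_frac_power\<close>, applying \<open>B\<close> and convolving with \<open>g \<alpha>\<close> maps each term of the series to the next one.
\<close>

lemma mittag_leffler_equation:
  assumes t: "t \<ge> 0"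
  shows "mittag_leffler t x = x + conv (g \<alpha>) (\<lambda>s. B (mittag_leffler s x)) t"
proof (rule LIMSEQ_unique)
  define P where "P n s = (\<Sum>k<n. frac_power (real k * \<alpha>) s *\<^sub>R (B ^^ k) x)" for n s
  have cP: "continuous_on {0..t} (P n)" for n
    unfolding P_def by (rule continuous_on_partial_sum)
  have limP: "uniform_limit {0..t} P (\<lambda>s. mittag_leffler s x) sequentially"
    using uniform_limit_mittag_leffler[OF t] by (simp add: P_def[abs_def])
  have rec: "P (Suc n) t = x + conv (g \<alpha>) (\<lambda>s. B (P n s)) t" for n
  proof -
    have "conv (g \<alpha>) (\<lambda>s. frac_power (real k * \<alpha>) s *\<^sub>R (B ^^ Suc k) x) t = frac_power (real (Suc k) * \<alpha>) t *\<^sub>R (B ^^ Suc k) x" for k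
      using conv_linear[OF bounded_linear_scaleR_left, of \<alpha> t "frac_power (real k * \<alpha>)" "(B ^^ Suc k) x"] t \<alpha>
        conv_frac_power[of \<alpha> "real k * \<alpha>" t]
      by (simp add: continuous_on_subset[OF continuous_on_frac_power] algebra_simps del: funpow.simps)
    then have "(\<Sum>k<n. frac_power (real (Suc k) * \<alpha>) t *\<^sub>R (B ^^ Suc k) x) =
        (\<Sum>k<n. conv (g \<alpha>) (\<lambda>s. frac_power (real k * \<alpha>) s *\<^sub>R (B ^^ Suc k) x) t)" by simp
    also have "\<dots> = conv (g \<alpha>) (\<lambda>s. \<Sum>k<n. frac_power (real k * \<alpha>) s *\<^sub>R (B ^^ Suc k) x) t"
      using \<alpha> t by (intro conv_sum[symmetric] continuous_intros continuous_on_subset[OF continuous_on_frac_power]) auto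
    also have "(\<lambda>s. \<Sum>k<n. frac_power (real k * \<alpha>) s *\<^sub>R (B ^^ Suc k) x) = (\<lambda>s. B (P n s))"
      by (simp add: P_def linear_sum[OF bounded_linear.linear[OF B]] linear_cmul[OF bounded_linear.linear[OF B]])
    finally show ?thesis
      unfolding P_def sum.lessThan_Suc_shift by (simp add: frac_power_def)
  qed
  have "(\<lambda>n. P n t) \<longlonglongrightarrow> mittag_leffler t x"
    using t by (intro tendsto_uniform_limitI[OF limP]) simp
  then show "(\<lambda>n. P (Suc n) t) \<longlonglongrightarrow> mittag_leffler t x" by (rule LIMSEQ_Suc)
  have "(\<lambda>n. conv (g \<alpha>) (\<lambda>s. B (P n s)) t) \<longlonglongrightarrow> conv (g \<alpha>) (\<lambda>s. B (mittag_leffler s x)) t"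
    using \<alpha> t by (intro conv_tendsto bounded_linear.uniform_limit[OF B limP] bounded_linear.continuous_on[OF B cP])
  then show "(\<lambda>n. P (Suc n) t) \<longlonglongrightarrow> x + conv (g \<alpha>) (\<lambda>s. B (mittag_leffler s x)) t"
    unfolding rec by (intro tendsto_intros)
qed

lemma mittag_leffler_0: "mittag_leffler 0 x = x"
  using mittag_leffler_equation[of 0 x] by (simp add: conv_def)

lemma mittag_leffler_derivative:
  "t \<ge> 0 \<Longrightarrow> (conv (g (1 - \<alpha>)) (\<lambda>s. mittag_leffler s x - x) has_vector_derivative B (mittag_leffler t x)) (at t within {0..})"
  using \<alpha> by (intro caputo_derivative_of_integral_equation[OF _ _ continuous_on_B_mittag_leffler mittag_leffler_equation])

lemma mittag_leffler_lipschitz: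
  assumes t: "t > 0"
  obtains L where "\<And>s. s \<in> {t/2..t} \<Longrightarrow> norm (mittag_leffler t x - mittag_leffler s x) \<le> L * (t - s)"
proof
  fix s assume s: "s \<in> {t/2..t}"
  let ?h = "\<lambda>k. norm x * (2 * \<alpha> / t) * ((2 * onorm B) ^ k * frac_power (real k * \<alpha>) t)"
  have h: "summable ?h"
    using \<alpha> t onorm_pos_le[OF B] by (intro summable_mult summable_frac_power) auto
  have "norm (mittag_leffler t x - mittag_leffler s x) =
      norm (\<Sum>k. frac_power (real k * \<alpha>) t *\<^sub>R (B ^^ k) x - frac_power (real k * \<alpha>) s *\<^sub>R (B ^^ k) x)"
    unfolding mittag_leffler_def using s t by (subst suminf_diff) (auto intro!: summable_mittag_leffler)
  also have "\<dots> \<le> (\<Sum>k. ?h k * (t - s))"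
  proof (rule suminf_norm_le[OF summable_mult2[OF h]])
    fix k
    have "norm (frac_power (real k * \<alpha>) t *\<^sub>R (B ^^ k) x - frac_power (real k * \<alpha>) s *\<^sub>R (B ^^ k) x) =
        \<bar>frac_power (real k * \<alpha>) t - frac_power (real k * \<alpha>) s\<bar> * norm ((B ^^ k) x)"
      by (simp flip: scaleR_diff_left)
    also have "\<dots> \<le> (2 * (real k * \<alpha>) / t * frac_power (real k * \<alpha>) t * (t - s)) * (onorm B ^ k * norm x)"
      using \<alpha> t s by (intro mult_mono frac_power_left_lipschitz norm_B_power) (auto simp: frac_power_nonneg)
    also have "\<dots> \<le> (2 * (2 ^ k * \<alpha>) / t * frac_power (real k * \<alpha>) t * (t - s)) * (onorm B ^ k * norm x)"
    proof (intro mult_right_mono divide_right_mono mult_left_mono)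
      show "real k \<le> 2 ^ k" using of_nat_less_two_power[of k, where 'a = real] by simp
    qed (use \<alpha> t s onorm_pos_le[OF B] in \<open>auto simp: frac_power_nonneg\<close>)
    finally show "norm (frac_power (real k * \<alpha>) t *\<^sub>R (B ^^ k) x - frac_power (real k * \<alpha>) s *\<^sub>R (B ^^ k) x) \<le> ?h k * (t - s)"
      by (simp add: power_mult_distrib mult_ac)
  qed
  also have "\<dots> = suminf ?h * (t - s)" by (rule suminf_mult2[OF h, symmetric])
  finally show "norm (mittag_leffler t x - mittag_leffler s x) \<le> suminf ?h * (t - s)" .
qed

text \<open>
  The series inherits the commutation relations of \<open>B\<close>. This yields homogeneity, the commutation of
  different Yosida approximations, of the resolvent and of scalars with the solution.
\<close>

lemma mittag_leffler_commute:
  assumes C: "bounded_linear C" and CB: "\<And>x. C (B x) = B (C x)" and t: "t \<ge> 0"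
  shows "C (mittag_leffler t x) = mittag_leffler t (C x)"
proof -
  have "C ((B ^^ k) x) = (B ^^ k) (C x)" for k by (induction k) (simp_all add: CB)
  then show ?thesis
    unfolding mittag_leffler_def bounded_linear.suminf[OF C summable_mittag_leffler[OF t]]
    by (simp add: linear_cmul[OF bounded_linear.linear[OF C]])
qed

lemma mittag_leffler_add:
  assumes "t \<ge> 0" shows "mittag_leffler t (x + y) = mittag_leffler t x + mittag_leffler t y"
proof -
  have "(B ^^ k) (x + y) = (B ^^ k) x + (B ^^ k) y" for k
    by (induction k) (simp_all add: linear_add[OF bounded_linear.linear[OF B]])
  then show ?thesis
    unfolding mittag_leffler_def by (simp add: suminf_add[OF summable_mittag_leffler[OF assms] summable_mittag_leffler[OF assms]] scaleR_add_right)
qed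

lemma mittag_leffler_scaleR: "t \<ge> 0 \<Longrightarrow> mittag_leffler t (r *\<^sub>R x) = r *\<^sub>R mittag_leffler t x"
  by (rule mittag_leffler_commute[symmetric, OF bounded_linear_scaleR_right])
    (simp add: linear_cmul[OF bounded_linear.linear[OF B]])

end

locale dissipative_equation = bounded_equation +
  assumes B_dissipative: "B x \<bullet> x \<le> 0"
begin

text \<open>
  At a maximum \<open>\<tau> > 0\<close> of the norm on \<open>{0..t}\<close> the energy inequality and dissipativity give
  \<open>(norm (v \<tau>))\<^sup>2 \<le> x \<bullet> v \<tau>\<close>, where \<open>v\<close> is the solution.
\<close>

lemma norm_mittag_leffler_le:
  assumes t: "t \<ge> 0"
  shows "norm (mittag_leffler t x) \<le> norm x"
proof -
  have c: "continuous_on {0..s} (\<lambda>s. mittag_leffler s x)" for s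
    by (rule continuous_on_subset[OF continuous_on_mittag_leffler]) auto
  obtain \<tau> where \<tau>: "\<tau> \<in> {0..t}" and max: "\<And>s. s \<in> {0..t} \<Longrightarrow> norm (mittag_leffler s x) \<le> norm (mittag_leffler \<tau> x)"
    using attains_max_norm[OF c t] by blast
  have "norm (mittag_leffler \<tau> x) \<le> norm x"
  proof (cases "\<tau> = 0")
    case False
    then have pos: "\<tau> > 0" using \<tau> by auto
    obtain L where L: "\<And>s. s \<in> {\<tau>/2..\<tau>} \<Longrightarrow> norm (mittag_leffler \<tau> x - mittag_leffler s x) \<le> L * (\<tau> - s)"
      using mittag_leffler_lipschitz[OF pos] by blast
    have d: "(conv (g (1 - \<alpha>)) (\<lambda>s. mittag_leffler s x - x) has_vector_derivative B (mittag_leffler \<tau> x)) (at \<tau> within {0..\<tau>})"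
      using pos by (intro has_vector_derivative_within_subset[OF mittag_leffler_derivative]) auto
    have "g (1 - \<alpha>) \<tau> * ((norm (mittag_leffler \<tau> x))\<^sup>2 - x \<bullet> mittag_leffler \<tau> x) \<le> B (mittag_leffler \<tau> x) \<bullet> mittag_leffler \<tau> x"
      using \<tau> by (intro energy_inequality[OF \<alpha> pos c max L d]) auto
    also have "\<dots> \<le> 0" by (rule B_dissipative)
    finally have "(norm (mittag_leffler \<tau> x))\<^sup>2 \<le> x \<bullet> mittag_leffler \<tau> x"
      using g_pos[of "1 - \<alpha>" \<tau>] pos \<alpha> by (simp add: mult_le_0_iff)
    also have "\<dots> \<le> norm x * norm (mittag_leffler \<tau> x)" by (rule norm_cauchy_schwarz)
    finally show ?thesis by (cases "mittag_leffler \<tau> x = 0") (simp_all add: power2_eq_square)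
  qed (simp add: mittag_leffler_0)
  then show ?thesis using max[of t] t by simp
qed

lemma bounded_linear_mittag_leffler: "t \<ge> 0 \<Longrightarrow> bounded_linear (mittag_leffler t)"
  by (rule bounded_linear_intro[where K = 1]) (simp_all add: mittag_leffler_add mittag_leffler_scaleR norm_mittag_leffler_le)

end

section \<open>Resolvent and Yosida approximation of an m-dissipative operator\<close>

text \<open>
  The real part of the theory, which carries the analysis; linearity over the scalar field is
  recovered at the end by \<open>sol_commute\<close>.
\<close>

locale m_dissipative_operator =
  fixes D :: "'a::{real_inner,complete_space} set" and A :: "'a \<Rightarrow> 'a"
  assumes add: "x \<in> D \<Longrightarrow> y \<in> D \<Longrightarrow> x + y \<in> D \<and> A (x + y) = A x + A y"
    and scale: "x \<in> D \<Longrightarrow> r *\<^sub>R x \<in> D \<and> A (r *\<^sub>R x) = r *\<^sub>R A x"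
    and diss: "x \<in> D \<Longrightarrow> A x \<bullet> x \<le> 0"
    and range: "\<exists>r>0. (\<lambda>x. r *\<^sub>R x - A x) ` D = UNIV"
begin

lemma diff: "x \<in> D \<Longrightarrow> y \<in> D \<Longrightarrow> x - y \<in> D \<and> A (x - y) = A x - A y"
  using add[of x "(-1) *\<^sub>R y"] scale[of y "-1"] by simp

lemma coercive:
  assumes "x \<in> D"
  shows "\<nu> * norm x \<le> norm (\<nu> *\<^sub>R x - A x)"
proof (cases "x = 0")
  case False
  have "\<nu> * (norm x)\<^sup>2 \<le> (\<nu> *\<^sub>R x - A x) \<bullet> x"
    using diss[OF assms] by (simp add: inner_diff_left power2_norm_eq_inner)
  also have "\<dots> \<le> norm (\<nu> *\<^sub>R x - A x) * norm x" by (rule norm_cauchy_schwarz)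
  finally show ?thesis using False by (simp add: power2_eq_square)
qed simp

text \<open>
  With \<open>R\<close> the resolvent at \<open>\<nu>\<close>, the vector \<open>x = R z\<close> solves \<open>\<mu> *\<^sub>R x - A x = y\<close> if and only if
  \<open>z = y + (\<nu> - \<mu>) *\<^sub>R R z\<close>. This fixed point equation is a contraction for \<open>\<bar>\<nu> - \<mu>\<bar> < \<nu>\<close>.
\<close>

lemma range_step:
  assumes \<nu>: "(\<lambda>x. \<nu> *\<^sub>R x - A x) ` D = UNIV" and \<mu>: "0 < \<mu>" "\<mu> < 2 * \<nu>"
  shows "(\<lambda>x. \<mu> *\<^sub>R x - A x) ` D = UNIV"
proof -
  have pos: "\<nu> > 0" using \<mu> by simp
  have "\<forall>y. \<exists>x. x \<in> D \<and> \<nu> *\<^sub>R x - A x = y"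
  proof
    fix y
    have "y \<in> (\<lambda>x. \<nu> *\<^sub>R x - A x) ` D" using \<nu> by simp
    then show "\<exists>x. x \<in> D \<and> \<nu> *\<^sub>R x - A x = y" by auto
  qed
  from choice[OF this] obtain R where R: "\<And>y. R y \<in> D" "\<And>y. \<nu> *\<^sub>R R y - A (R y) = y" by blast
  have R_lip: "norm (R y - R z) \<le> norm (y - z) / \<nu>" for y z
  proof -
    have d: "R y - R z \<in> D" "A (R y - R z) = A (R y) - A (R z)"
      using diff[OF R(1) R(1)] by blast+
    have "\<nu> *\<^sub>R (R y - R z) - A (R y - R z) = (\<nu> *\<^sub>R R y - A (R y)) - (\<nu> *\<^sub>R R z - A (R z))"
      by (simp add: d(2) algebra_simps)
    also have "\<dots> = y - z" by (simp only: R(2))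
    finally show ?thesis
      using coercive[OF d(1), of \<nu>] pos by (simp add: pos_le_divide_eq mult.commute)
  qed
  have "y \<in> (\<lambda>x. \<mu> *\<^sub>R x - A x) ` D" for y
  proof -
    have "\<exists>!z. y + (\<nu> - \<mu>) *\<^sub>R R z = z"
    proof (rule banach_fix_type[where c = "\<bar>\<nu> - \<mu>\<bar> / \<nu>"])
      show "\<bar>\<nu> - \<mu>\<bar> / \<nu> < 1" "0 \<le> \<bar>\<nu> - \<mu>\<bar> / \<nu>" using \<mu> pos by (auto simp: abs_less_iff)
      have "dist (y + (\<nu> - \<mu>) *\<^sub>R R z) (y + (\<nu> - \<mu>) *\<^sub>R R z') \<le> \<bar>\<nu> - \<mu>\<bar> / \<nu> * dist z z'" for z z' :: 'a
      proof -
        have "dist (y + (\<nu> - \<mu>) *\<^sub>R R z) (y + (\<nu> - \<mu>) *\<^sub>R R z') = \<bar>\<nu> - \<mu>\<bar> * norm (R z - R z')"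
          by (simp add: dist_norm flip: scaleR_diff_right)
        also have "\<dots> \<le> \<bar>\<nu> - \<mu>\<bar> * (norm (z - z') / \<nu>)" by (intro mult_left_mono R_lip) simp
        finally show ?thesis by (simp add: dist_norm)
      qed
      then show "\<forall>z z'. dist (y + (\<nu> - \<mu>) *\<^sub>R R z) (y + (\<nu> - \<mu>) *\<^sub>R R z') \<le> \<bar>\<nu> - \<mu>\<bar> / \<nu> * dist z z'"
        by blast
    qed
    then obtain z where "y + (\<nu> - \<mu>) *\<^sub>R R z = z" by auto
    then have "\<mu> *\<^sub>R R z - A (R z) = y" using R(2)[of z] by (simp add: algebra_simps)
    then show ?thesis by (intro image_eqI[of _ _ "R z"]) (simp_all add: R(1))
  qed
  then show ?thesis by auto
qed

text \<open>
  By \<open>range_step\<close> the range condition passes from \<open>r\<close> to \<open>3/2 * r\<close>, hence to arbitrarily large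
  parameters, and from each of these to all smaller ones.
\<close>

lemma range_all:
  assumes "\<mu> > 0"
  shows "(\<lambda>x. \<mu> *\<^sub>R x - A x) ` D = UNIV"
proof -
  obtain r where r: "r > 0" "(\<lambda>x. r *\<^sub>R x - A x) ` D = UNIV" using range by blast
  have surj: "(\<lambda>x. (r * (3/2) ^ n) *\<^sub>R x - A x) ` D = UNIV" for n
  proof (induction n)
    case (Suc n)
    show ?case by (rule range_step[OF Suc]) (use r in auto)
  qed (use r in simp)
  obtain n where "\<mu> / r < (3/2) ^ n" using real_arch_pow[of "3/2" "\<mu> / r"] by auto
  then have "\<mu> < r * (3/2) ^ n" using r by (simp add: field_simps)
  then show ?thesis using assms by (intro range_step[OF surj[of n]]) auto
qed

definition resolvent :: "real \<Rightarrow> 'a \<Rightarrow> 'a" where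
  "resolvent \<nu> y = (SOME x. x \<in> D \<and> \<nu> *\<^sub>R x - A x = y)"

context
  fixes \<nu> :: real assumes \<nu>: "\<nu> > 0"
begin

lemma resolvent_props: "resolvent \<nu> y \<in> D \<and> \<nu> *\<^sub>R resolvent \<nu> y - A (resolvent \<nu> y) = y"
proof -
  have "y \<in> (\<lambda>x. \<nu> *\<^sub>R x - A x) ` D" using range_all[OF \<nu>] by simp
  then have "\<exists>x. x \<in> D \<and> \<nu> *\<^sub>R x - A x = y" by auto
  then show ?thesis unfolding resolvent_def by (rule someI_ex)
qed

lemma resolvent_mem: "resolvent \<nu> y \<in> D"
  using resolvent_props by blast

lemma A_resolvent: "A (resolvent \<nu> y) = \<nu> *\<^sub>R resolvent \<nu> y - y"
  using resolvent_props[of y] by (simp add: algebra_simps)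

lemma resolvent_unique:
  assumes x: "x \<in> D"
  shows "resolvent \<nu> (\<nu> *\<^sub>R x - A x) = x"
proof -
  let ?z = "resolvent \<nu> (\<nu> *\<^sub>R x - A x)"
  have d: "?z - x \<in> D" "A (?z - x) = A ?z - A x"
    using diff[OF resolvent_mem x] by blast+
  have "\<nu> * norm (?z - x) \<le> norm (\<nu> *\<^sub>R (?z - x) - A (?z - x))"
    by (rule coercive[OF d(1)])
  also have "\<nu> *\<^sub>R (?z - x) - A (?z - x) = 0"
    unfolding d(2) A_resolvent by (simp add: algebra_simps)
  finally show ?thesis using \<nu> by (simp add: mult_le_0_iff)
qed

lemma norm_resolvent_le: "\<nu> * norm (resolvent \<nu> y) \<le> norm y"
  using coercive[OF resolvent_mem, of \<nu> y] by (simp add: A_resolvent)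

text \<open>
  Both sides are mapped to \<open>C y\<close> by the injective operator \<open>\<nu> - A\<close>.
\<close>

lemma resolvent_commute:
  assumes "linear C" and C: "\<And>x. x \<in> D \<Longrightarrow> C x \<in> D \<and> A (C x) = C (A x)"
  shows "C (resolvent \<nu> y) = resolvent \<nu> (C y)"
proof -
  have "C y = C (\<nu> *\<^sub>R resolvent \<nu> y - A (resolvent \<nu> y))" by (simp add: A_resolvent)
  also have "\<dots> = \<nu> *\<^sub>R C (resolvent \<nu> y) - A (C (resolvent \<nu> y))"
    using C[OF resolvent_mem] by (simp add: linear_diff[OF assms(1)] linear_cmul[OF assms(1)])
  finally show ?thesis using C[OF resolvent_mem] resolvent_unique by metis
qed

lemma bounded_linear_resolvent: "bounded_linear (resolvent \<nu>)"
proof (rule bounded_linear_intro)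
  fix x y :: 'a and r :: real
  let ?x = "resolvent \<nu> x" and ?y = "resolvent \<nu> y"
  have "\<nu> *\<^sub>R (?x + ?y) - A (?x + ?y) = x + y"
    using add[OF resolvent_mem[of x] resolvent_mem[of y]] by (simp add: A_resolvent algebra_simps)
  then show "resolvent \<nu> (x + y) = ?x + ?y"
    using resolvent_unique add[OF resolvent_mem[of x] resolvent_mem[of y]] by metis
  have "\<nu> *\<^sub>R (r *\<^sub>R ?x) - A (r *\<^sub>R ?x) = r *\<^sub>R x"
    using scale[OF resolvent_mem[of x], of r] by (simp add: A_resolvent algebra_simps)
  then show "resolvent \<nu> (r *\<^sub>R x) = r *\<^sub>R ?x"
    using resolvent_unique scale[OF resolvent_mem[of x], of r] by metis
  show "norm ?x \<le> norm x * (1 / \<nu>)"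
    using norm_resolvent_le[of x] \<nu> by (simp add: field_simps)
qed

lemmas linear_resolvent = bounded_linear.linear[OF bounded_linear_resolvent]

lemma resolvent_A:
  assumes "x \<in> D" shows "resolvent \<nu> (A x) = A (resolvent \<nu> x)"
proof -
  have "resolvent \<nu> (A x) = resolvent \<nu> (\<nu> *\<^sub>R x - (\<nu> *\<^sub>R x - A x))" by simp
  also have "\<dots> = A (resolvent \<nu> x)"
    by (subst linear_diff[OF linear_resolvent])
      (simp add: linear_cmul[OF linear_resolvent] resolvent_unique[OF assms] A_resolvent)
  finally show ?thesis .
qed

end

lemma resolvent_resolvent:
  assumes "\<nu> > 0" "\<mu> > 0"
  shows "resolvent \<nu> (resolvent \<mu> y) = resolvent \<mu> (resolvent \<nu> y)"
  using assms by (intro resolvent_commute linear_resolvent) (auto simp: resolvent_mem resolvent_A)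

text \<open>
  The regularisation \<open>J\<^sub>\<nu> = \<nu> (\<nu> - A)\<^sup>-\<^sup>1\<close> for \<open>\<nu> = n + 1\<close>.
\<close>

definition approx :: "nat \<Rightarrow> 'a \<Rightarrow> 'a" where
  "approx n y = real (Suc n) *\<^sub>R resolvent (real (Suc n)) y"

lemma approx_mem: "approx n y \<in> D"
  unfolding approx_def using resolvent_mem scale by simp

lemma bounded_linear_approx: "bounded_linear (approx n)"
  unfolding approx_def by (intro bounded_linear_const_scaleR bounded_linear_resolvent) simp

lemmas linear_approx = bounded_linear.linear[OF bounded_linear_approx]

lemma norm_approx_le: "norm (approx n y) \<le> norm y"
  using norm_resolvent_le[of "real (Suc n)" y] by (simp add: approx_def)

lemma A_approx: "A (approx n y) = real (Suc n) *\<^sub>R (approx n y - y)"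
  using scale[OF resolvent_mem] A_resolvent[of "real (Suc n)"] by (simp add: approx_def)

lemma approx_A: "x \<in> D \<Longrightarrow> approx n (A x) = A (approx n x)"
  using scale[OF resolvent_mem] by (simp add: approx_def resolvent_A)

lemma approx_tendsto_on_domain:
  assumes "y \<in> D" shows "(\<lambda>n. approx n y) \<longlonglongrightarrow> y"
proof (rule LIM_zero_cancel, rule Lim_null_comparison)
  have "norm (approx n y - y) \<le> norm (A y) / real (Suc n)" for n
  proof -
    have "real (Suc n) * norm (approx n y - y) = norm (A (approx n y))"
      unfolding A_approx by simp
    also have "\<dots> \<le> norm (A y)" using norm_approx_le[of n "A y"] assms by (simp add: approx_A)
    finally show ?thesis by (simp add: field_simps)
  qed
  then show "\<forall>\<^sub>F n in sequentially. norm (approx n y - y) \<le> norm (A y) / real (Suc n)" by simp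
  show "(\<lambda>n. norm (A y) / real (Suc n)) \<longlonglongrightarrow> 0"
    using LIMSEQ_Suc[OF lim_const_over_n[of "norm (A y)"]] by simp
qed

lemma approx_tendsto_on_closure:
  assumes y: "Y \<longlonglongrightarrow> y" "\<And>m. Y m \<in> D"
  shows "(\<lambda>n. approx n y) \<longlonglongrightarrow> y"
proof (rule tendstoI)
  fix \<epsilon> :: real assume \<epsilon>: "\<epsilon> > 0"
  then have "\<forall>\<^sub>F m in sequentially. dist (Y m) y < \<epsilon> / 3"
    using y(1) by (intro tendstoD) auto
  then obtain m where m: "dist (Y m) y < \<epsilon> / 3" using eventually_happens'[OF sequentially_bot] by blast
  have "\<forall>\<^sub>F n in sequentially. dist (approx n (Y m)) (Y m) < \<epsilon> / 3"
    using approx_tendsto_on_domain[OF y(2)] \<epsilon> by (intro tendstoD) auto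
  then show "\<forall>\<^sub>F n in sequentially. dist (approx n y) y < \<epsilon>"
  proof (rule eventually_mono)
    fix n assume n: "dist (approx n (Y m)) (Y m) < \<epsilon> / 3"
    have "dist (approx n y) (approx n (Y m)) \<le> dist y (Y m)"
      using norm_approx_le[of n "y - Y m"] by (simp add: dist_norm linear_diff[OF linear_approx])
    then show "dist (approx n y) y < \<epsilon>"
      using m n dist_triangle[of "approx n y" y "approx n (Y m)"] dist_triangle[of "approx n (Y m)" y "Y m"]
      by (simp add: dist_commute)
  qed
qed

text \<open>
  Let \<open>p\<close> and \<open>q\<close> be the errors for the parameters \<open>a \<le> b\<close>. Since \<open>A (approx n y)\<close> is \<open>-a\<close> times the error,
  dissipativity applied to the difference of the two approximations reads
  \<open>a (norm p)\<^sup>2 + b (norm q)\<^sup>2 \<le> (a + b) (p \<bullet> q)\<close>. Polarisation turns this into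
  \<open>(a + b) (norm (p - q))\<^sup>2 \<le> (b - a) ((norm p)\<^sup>2 - (norm q)\<^sup>2)\<close>.
\<close>

lemma approx_error_decrease:
  fixes y :: 'a
  defines "p \<equiv> \<lambda>k. y - approx k y"
  assumes "n \<le> m"
  shows "(norm (p n - p m))\<^sup>2 \<le> (norm (p n))\<^sup>2 - (norm (p m))\<^sup>2"
proof (cases "n = m")
  case False
  define a b where "a = real (Suc n)" and "b = real (Suc m)"
  have ab: "a < b" "a > 0" using False assms(2) by (auto simp: a_def b_def)
  have "A (approx n y - approx m y) \<bullet> (approx n y - approx m y) \<le> 0"
    using diff[OF approx_mem approx_mem] by (intro diss) blast
  also have "A (approx n y - approx m y) = b *\<^sub>R p m - a *\<^sub>R p n"
    using diff[OF approx_mem approx_mem, of n y m y]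
    by (simp add: A_approx p_def algebra_simps a_def b_def)
  also have "approx n y - approx m y = p m - p n" by (simp add: p_def)
  finally have "a * (p n \<bullet> p n) + b * (p m \<bullet> p m) \<le> (a + b) * (p n \<bullet> p m)"
    by (simp add: inner_diff_left inner_diff_right inner_commute algebra_simps)
  then have *: "(a + b) * (norm (p n - p m))\<^sup>2 \<le> (b - a) * ((norm (p n))\<^sup>2 - (norm (p m))\<^sup>2)"
    by (simp add: power2_norm_eq_inner inner_diff_left inner_diff_right inner_commute algebra_simps)
  moreover have "0 \<le> (a + b) * (norm (p n - p m))\<^sup>2" using ab by simp
  ultimately have "0 \<le> (norm (p n))\<^sup>2 - (norm (p m))\<^sup>2"
    using ab by (smt (verit) zero_le_mult_iff)
  then have "(b - a) * ((norm (p n))\<^sup>2 - (norm (p m))\<^sup>2) \<le> (a + b) * ((norm (p n))\<^sup>2 - (norm (p m))\<^sup>2)"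
    using ab by (intro mult_right_mono) auto
  with * have "(a + b) * (norm (p n - p m))\<^sup>2 \<le> (a + b) * ((norm (p n))\<^sup>2 - (norm (p m))\<^sup>2)" by simp
  then show ?thesis using ab by simp
qed simp

text \<open>
  This contains the density of the domain. By \<open>approx_error_decrease\<close> the errors form a Cauchy sequence; let \<open>q\<close> be their limit. Then
  \<open>approx n q\<close> tends to 0, and so does \<open>approx n (resolvent 1 q) = resolvent 1 (approx n q)\<close>. But
  \<open>resolvent 1 q\<close> lies in the domain, so this sequence also tends to \<open>resolvent 1 q\<close>, and \<open>q = 0\<close>.
\<close>

theorem approx_tendsto: "(\<lambda>n. approx n y) \<longlonglongrightarrow> y"
proof -
  define p where "p k = y - approx k y" for k
  have le: "(norm (p n - p m))\<^sup>2 \<le> (norm (p n))\<^sup>2 - (norm (p m))\<^sup>2" if "n \<le> m" for n m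
    using approx_error_decrease[OF that] by (simp add: p_def)
  have "decseq (\<lambda>n. (norm (p n))\<^sup>2)"
  proof (rule decseq_SucI)
    fix n show "(norm (p (Suc n)))\<^sup>2 \<le> (norm (p n))\<^sup>2"
      using le[of n "Suc n"] zero_le_power2[of "norm (p n - p (Suc n))"] by linarith
  qed
  then have "convergent (\<lambda>n. (norm (p n))\<^sup>2)"
    by (metis decseq_convergent convergent_def zero_le_power2)
  then have cau: "Cauchy (\<lambda>n. (norm (p n))\<^sup>2)" by (rule convergent_Cauchy)
  \<comment> \<open>the squared norms decrease, hence converge, and control the distances\<close>
  have "Cauchy p"
  proof (rule metric_CauchyI)
    fix \<epsilon> :: real assume "\<epsilon> > 0"
    then obtain N where N: "\<And>m n. m \<ge> N \<Longrightarrow> n \<ge> N \<Longrightarrow> dist ((norm (p m))\<^sup>2) ((norm (p n))\<^sup>2) < \<epsilon>\<^sup>2"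
      using metric_CauchyD[OF cau, of "\<epsilon>\<^sup>2"] by auto
    have *: "dist (p m) (p n) < \<epsilon>" if "N \<le> m" "m \<le> n" for m n
    proof -
      have "(norm (p m - p n))\<^sup>2 < \<epsilon>\<^sup>2"
        using le[OF that(2)] N[of m n] that by (simp add: dist_real_def)
      then show ?thesis using \<open>\<epsilon> > 0\<close> by (simp add: dist_norm power2_less_imp_less)
    qed
    show "\<exists>M. \<forall>m\<ge>M. \<forall>n\<ge>M. dist (p m) (p n) < \<epsilon>"
      using * by (metis dist_commute nle_le)
  qed
  then obtain q where q: "p \<longlonglongrightarrow> q" using Cauchy_convergent convergent_def by blast
  have lim: "(\<lambda>n. approx n y) \<longlonglongrightarrow> y - q"
    using tendsto_diff[OF tendsto_const q, of y] by (simp add: p_def)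
  have "(\<lambda>n. approx n (y - q)) \<longlonglongrightarrow> y - q"
    by (rule approx_tendsto_on_closure[OF lim approx_mem])
  with lim have "(\<lambda>n. approx n y - approx n (y - q)) \<longlonglongrightarrow> (y - q) - (y - q)"
    by (rule tendsto_diff)
  then have "(\<lambda>n. approx n q) \<longlonglongrightarrow> 0"
    by (simp add: linear_diff[OF linear_approx])
  then have "(\<lambda>n. resolvent 1 (approx n q)) \<longlonglongrightarrow> resolvent 1 0"
    by (intro bounded_linear.tendsto[OF bounded_linear_resolvent]) simp_all
  moreover have "resolvent 1 (approx n q) = approx n (resolvent 1 q)" for n
    by (simp add: approx_def linear_cmul[OF linear_resolvent] resolvent_resolvent[of 1])
  moreover have "(\<lambda>n. approx n (resolvent 1 q)) \<longlonglongrightarrow> resolvent 1 q"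
    by (intro approx_tendsto_on_domain resolvent_mem) simp
  ultimately have "resolvent 1 q = resolvent 1 0" using LIMSEQ_unique by fastforce
  then have "q = 0" using resolvent_props[of 1 q] resolvent_props[of 1 0] by simp
  with lim show ?thesis by simp
qed

definition yosida :: "nat \<Rightarrow> 'a \<Rightarrow> 'a" where
  "yosida n y = A (approx n y)"

lemma bounded_linear_yosida: "bounded_linear (yosida n)"
  unfolding yosida_def A_approx
  by (intro bounded_linear_const_scaleR bounded_linear_sub bounded_linear_approx bounded_linear_ident)

text \<open>
  Since \<open>y = approx n y - yosida n y / (n + 1)\<close>, the inner product is that of \<open>A (approx n y)\<close> with
  \<open>approx n y\<close> minus a nonnegative term.
\<close>

lemma yosida_dissipative: "yosida n y \<bullet> y \<le> 0"
proof -
  have y: "y = approx n y - (1 / real (Suc n)) *\<^sub>R yosida n y"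
    by (simp add: yosida_def A_approx)
  have "yosida n y \<bullet> y = A (approx n y) \<bullet> approx n y - (1 / real (Suc n)) * (norm (yosida n y))\<^sup>2"
    by (subst (2) y) (simp add: inner_diff_right yosida_def power2_norm_eq_inner)
  moreover have "0 \<le> (1 / real (Suc n)) * (norm (yosida n y))\<^sup>2" by simp
  ultimately show ?thesis using diss[OF approx_mem, of n y] by linarith
qed

lemma yosida_tendsto: "x \<in> D \<Longrightarrow> (\<lambda>n. yosida n x) \<longlonglongrightarrow> A x"
  using approx_tendsto[of "A x"] by (simp add: yosida_def approx_A)

lemma yosida_commute:
  assumes "linear C" and C: "\<And>x. x \<in> D \<Longrightarrow> C x \<in> D \<and> A (C x) = C (A x)"
  shows "C (yosida n y) = yosida n (C y)"
proof -
  have "C (approx n y) = approx n (C y)"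
    using resolvent_commute[OF _ assms, of "real (Suc n)"] by (simp add: approx_def linear_cmul[OF assms(1)])
  then show ?thesis using C[OF approx_mem] by (metis yosida_def)
qed

end

section \<open>Passage to the limit in the Yosida approximation\<close>

locale fractional_problem = m_dissipative_operator D A
  for D and A :: "'a::{real_inner,complete_space} \<Rightarrow> 'a" +
  fixes \<alpha> :: real
  assumes \<alpha>: "0 < \<alpha>" "\<alpha> < 1"
begin

sublocale yos: dissipative_equation \<alpha> "yosida n" for n
  by (intro dissipative_equation.intro bounded_equation.intro dissipative_equation_axioms.intro
      \<alpha> bounded_linear_yosida yosida_dissipative)

text \<open>\<open>V n t x\<close> solves the equation with \<open>A\<close> replaced by its Yosida approximation.\<close>

abbreviation "V \<equiv> yos.mittag_leffler"

lemma yosida_on_domain: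
  assumes "x \<in> D" shows "yosida n x \<in> D \<and> A (yosida n x) = yosida n (A x)"
proof -
  have "approx n x - x \<in> D \<and> A (approx n x - x) = A (approx n x) - A x"
    by (rule diff[OF approx_mem assms])
  moreover have "yosida n x = real (Suc n) *\<^sub>R (approx n x - x)"
    by (simp add: yosida_def A_approx)
  moreover have "yosida n (A x) = real (Suc n) *\<^sub>R (A (approx n x) - A x)"
    unfolding yosida_def by (subst A_approx) (simp add: approx_A[OF assms])
  ultimately show ?thesis using scale[of "approx n x - x" "real (Suc n)"] by metis
qed

lemma yosida_V: "t \<ge> 0 \<Longrightarrow> yosida n (V m t x) = V m t (yosida n x)"
  by (rule yos.mittag_leffler_commute[OF bounded_linear_yosida
        yosida_commute[OF bounded_linear.linear[OF bounded_linear_yosida] yosida_on_domain]])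

text \<open>
  The difference \<open>z\<close> of two approximate solutions starts at 0 and has the Caputo derivative
  \<open>A\<^sub>n z + V\<^sub>m (A\<^sub>n x - A\<^sub>m x)\<close>, because \<open>A\<^sub>n\<close> commutes with \<open>V\<^sub>m\<close>. At a maximum \<open>\<tau>\<close> of the norm the energy inequality
  bounds \<open>g (1 - \<alpha>) \<tau> * norm (z \<tau>)\<close> by the norm of the second summand.
\<close>

lemma norm_V_diff_le:
  assumes t: "t \<ge> 0"
  shows "norm (V n t x - V m t x) \<le> Gamma (1 - \<alpha>) * t powr \<alpha> * norm (yosida n x - yosida m x)"
proof -
  define z where "z s = V n s x - V m s x" for s
  define d where "d = norm (yosida n x - yosida m x)"
  have cV: "continuous_on {0..s} (\<lambda>s. V n s x)" for n s
    by (rule continuous_on_subset[OF yos.continuous_on_mittag_leffler]) auto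
  have cz: "continuous_on {0..s} z" for s
    unfolding z_def by (intro continuous_intros cV)
  have G: "Gamma (1 - \<alpha>) > 0" using \<alpha> by simp
  obtain \<tau> where \<tau>: "\<tau> \<in> {0..t}" and max: "\<And>s. s \<in> {0..t} \<Longrightarrow> norm (z s) \<le> norm (z \<tau>)"
    using attains_max_norm[OF cz t] by blast
  have "norm (z \<tau>) \<le> Gamma (1 - \<alpha>) * \<tau> powr \<alpha> * d"
  proof (cases "\<tau> = 0 \<or> z \<tau> = 0")
    case True
    then show ?thesis using G by (auto simp: z_def yos.mittag_leffler_0 d_def)
  next
    case False
    then have pos: "\<tau> > 0" and nz: "norm (z \<tau>) > 0" using \<tau> by auto
    define f where "f = yosida n (V n \<tau> x) - yosida m (V m \<tau> x)"
    obtain Ln where Ln: "\<And>s. s \<in> {\<tau>/2..\<tau>} \<Longrightarrow> norm (V n \<tau> x - V n s x) \<le> Ln * (\<tau> - s)"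
      using yos.mittag_leffler_lipschitz[OF pos] by blast
    obtain Lm where Lm: "\<And>s. s \<in> {\<tau>/2..\<tau>} \<Longrightarrow> norm (V m \<tau> x - V m s x) \<le> Lm * (\<tau> - s)"
      using yos.mittag_leffler_lipschitz[OF pos] by blast
    have L: "norm (z \<tau> - z s) \<le> (Ln + Lm) * (\<tau> - s)" if "s \<in> {\<tau>/2..\<tau>}" for s
    proof -
      have "norm (z \<tau> - z s) = norm ((V n \<tau> x - V n s x) - (V m \<tau> x - V m s x))"
        by (simp add: z_def algebra_simps)
      also have "\<dots> \<le> Ln * (\<tau> - s) + Lm * (\<tau> - s)"
        by (rule order_trans[OF norm_triangle_ineq4 add_mono[OF Ln[OF that] Lm[OF that]]])
      finally show ?thesis by (simp add: algebra_simps)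
    qed
    have "((\<lambda>r. conv (g (1 - \<alpha>)) (\<lambda>s. V n s x - x) r - conv (g (1 - \<alpha>)) (\<lambda>s. V m s x - x) r)
        has_vector_derivative f) (at \<tau> within {0..})"
      unfolding f_def using pos by (intro has_vector_derivative_diff yos.mittag_leffler_derivative) auto
    then have "(conv (g (1 - \<alpha>)) (\<lambda>s. z s - 0) has_vector_derivative f) (at \<tau> within {0..})"
    proof (rule has_vector_derivative_transform[rotated 2])
      fix r :: real assume "r \<in> {0..}"
      then show "conv (g (1 - \<alpha>)) (\<lambda>s. z s - 0) r =
          conv (g (1 - \<alpha>)) (\<lambda>s. V n s x - x) r - conv (g (1 - \<alpha>)) (\<lambda>s. V m s x - x) r"
        using \<alpha> by (subst conv_diff[symmetric]) (auto simp: z_def intro!: continuous_intros cV)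
    qed (use pos in simp)
    then have der: "(conv (g (1 - \<alpha>)) (\<lambda>s. z s - 0) has_vector_derivative f) (at \<tau> within {0..\<tau>})"
      by (rule has_vector_derivative_within_subset) auto
    have f: "f = yosida n (z \<tau>) + V m \<tau> (yosida n x - yosida m x)"
      using pos
      by (simp add: f_def z_def yosida_V linear_diff[OF bounded_linear.linear[OF bounded_linear_yosida]]
          linear_diff[OF bounded_linear.linear[OF yos.bounded_linear_mittag_leffler]])
    have "g (1 - \<alpha>) \<tau> * ((norm (z \<tau>))\<^sup>2 - 0 \<bullet> z \<tau>) \<le> f \<bullet> z \<tau>"
      using \<tau> by (intro energy_inequality[OF \<alpha> pos cz max L der]) auto
    also have "\<dots> \<le> V m \<tau> (yosida n x - yosida m x) \<bullet> z \<tau>"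
      using yosida_dissipative[of n "z \<tau>"] by (simp add: f inner_add_left)
    also have "\<dots> \<le> norm (V m \<tau> (yosida n x - yosida m x)) * norm (z \<tau>)"
      by (rule norm_cauchy_schwarz)
    also have "\<dots> \<le> d * norm (z \<tau>)"
      unfolding d_def using pos by (intro mult_right_mono yos.norm_mittag_leffler_le) auto
    finally have "g (1 - \<alpha>) \<tau> * norm (z \<tau>) \<le> d"
      using nz by (simp add: power2_eq_square)
    moreover have "g (1 - \<alpha>) \<tau> = 1 / (Gamma (1 - \<alpha>) * \<tau> powr \<alpha>)"
      using pos by (simp add: g_def powr_minus field_simps)
    ultimately show ?thesis
      using G pos by (simp add: pos_divide_le_eq mult_ac)
  qed
  also have "\<dots> \<le> Gamma (1 - \<alpha>) * t powr \<alpha> * d"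
    using G \<tau> \<alpha> by (intro mult_right_mono mult_left_mono powr_mono2) (auto simp: d_def)
  finally show ?thesis using max[of t] t by (simp add: z_def d_def)
qed

text \<open>
  For \<open>x\<close> in the domain this is \<open>norm_V_diff_le\<close>. In general \<open>x\<close> is replaced by the element \<open>approx k x\<close> of the
  domain, at a cost that is uniform in time because the approximate solutions are contractions.
\<close>

lemma uniformly_Cauchy_V:
  assumes T: "T \<ge> 0"
  shows "uniformly_Cauchy_on {0..T} (\<lambda>n t. V n t x)"
proof (rule uniformly_Cauchy_onI)
  fix \<epsilon> :: real assume \<epsilon>: "\<epsilon> > 0"
  have "\<forall>\<^sub>F k in sequentially. dist (approx k x) x < \<epsilon> / 3"
    using approx_tendsto \<epsilon> by (intro tendstoD) auto
  then obtain k where k: "dist (approx k x) x < \<epsilon> / 3"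
    using eventually_happens'[OF sequentially_bot] by blast
  define w where "w = approx k x"
  define C where "C = Gamma (1 - \<alpha>) * T powr \<alpha>"
  have C: "C \<ge> 0" using \<alpha> by (simp add: C_def Gamma_real_nonneg)
  have "Cauchy (\<lambda>n. yosida n w)"
    by (rule LIMSEQ_imp_Cauchy[OF yosida_tendsto]) (simp add: w_def approx_mem)
  then obtain N where N: "\<And>m n. m \<ge> N \<Longrightarrow> n \<ge> N \<Longrightarrow> dist (yosida m w) (yosida n w) < \<epsilon> / (3 * (C + 1))"
    using metric_CauchyD[of _ "\<epsilon> / (3 * (C + 1))"] \<epsilon> C by fastforce
  have "dist (V m t x) (V n t x) < \<epsilon>" if t: "t \<in> {0..T}" and mn: "m \<ge> N" "n \<ge> N" for t m n
  proof -
    have near: "dist (V i t x) (V i t w) < \<epsilon> / 3" for i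
    proof -
      have "dist (V i t x) (V i t w) = norm (V i t (x - w))"
        using t by (simp add: dist_norm linear_diff[OF bounded_linear.linear[OF yos.bounded_linear_mittag_leffler]])
      also have "\<dots> \<le> norm (x - w)" using t by (intro yos.norm_mittag_leffler_le) simp
      finally show ?thesis using k by (simp add: w_def dist_norm norm_minus_commute)
    qed
    have "dist (V m t w) (V n t w) \<le> Gamma (1 - \<alpha>) * t powr \<alpha> * norm (yosida m w - yosida n w)"
      using t by (simp add: dist_norm norm_V_diff_le)
    also have "\<dots> \<le> C * norm (yosida m w - yosida n w)"
      unfolding C_def using t \<alpha> by (intro mult_right_mono mult_left_mono powr_mono2) (auto simp: Gamma_real_nonneg)
    also have "\<dots> \<le> C * (\<epsilon> / (3 * (C + 1)))"
      using N[OF mn] C by (intro mult_left_mono) (auto simp: dist_norm)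
    also have "\<dots> \<le> \<epsilon> / 3" using C \<epsilon> by (simp add: field_simps)
    finally have "dist (V m t w) (V n t w) \<le> \<epsilon> / 3" .
    then show ?thesis
      using near[of m] near[of n] dist_triangle[of "V m t x" "V n t x" "V m t w"]
        dist_triangle[of "V m t w" "V n t x" "V n t w"] by (simp add: dist_commute)
  qed
  then show "\<exists>M. \<forall>t\<in>{0..T}. \<forall>m\<ge>M. \<forall>n\<ge>M. dist (V m t x) (V n t x) < \<epsilon>" by blast
qed

definition sol :: "real \<Rightarrow> 'a \<Rightarrow> 'a" where
  "sol t x = lim (\<lambda>n. V n t x)"

lemma uniform_limit_sol:
  assumes "T \<ge> 0"
  shows "uniform_limit {0..T} (\<lambda>n t. V n t x) (\<lambda>t. sol t x) sequentially"
  using Cauchy_uniformly_convergent[OF uniformly_Cauchy_V[OF assms]]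
  by (simp add: uniformly_convergent_uniform_limit_iff sol_def)

lemma sol_tendsto: "t \<ge> 0 \<Longrightarrow> (\<lambda>n. V n t x) \<longlonglongrightarrow> sol t x"
  using tendsto_uniform_limitI[OF uniform_limit_sol[of t x], of t] by simp

lemma continuous_on_sol: "continuous_on {0..} (\<lambda>t. sol t x)"
proof (rule continuous_on_half_line)
  fix T :: real assume "T \<ge> 0"
  then show "continuous_on {0..T} (\<lambda>t. sol t x)"
    by (intro uniform_limit_theorem[OF _ uniform_limit_sol] always_eventually allI
        continuous_on_subset[OF yos.continuous_on_mittag_leffler]) auto
qed

lemma sol_0: "sol 0 x = x"
  using LIMSEQ_unique[OF sol_tendsto[of 0 x]] by (simp add: yos.mittag_leffler_0)

lemma norm_sol_le: "t \<ge> 0 \<Longrightarrow> norm (sol t x) \<le> norm x"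
  by (rule LIMSEQ_le_const2[OF tendsto_norm[OF sol_tendsto]]) (auto intro: yos.norm_mittag_leffler_le)

lemma sol_commute:
  assumes C: "bounded_linear C" "\<And>x. x \<in> D \<Longrightarrow> C x \<in> D \<and> A (C x) = C (A x)" and t: "t \<ge> 0"
  shows "C (sol t x) = sol t (C x)"
proof (rule LIMSEQ_unique)
  show "(\<lambda>n. C (V n t x)) \<longlonglongrightarrow> C (sol t x)"
    by (rule bounded_linear.tendsto[OF C(1) sol_tendsto[OF t]])
  have "C (V n t x) = V n t (C x)" for n
    using C t by (intro yos.mittag_leffler_commute yosida_commute bounded_linear.linear) auto
  then show "(\<lambda>n. C (V n t x)) \<longlonglongrightarrow> sol t (C x)"
    using sol_tendsto[OF t, of "C x"] by simp
qed

lemma bounded_linear_sol: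
  assumes t: "t \<ge> 0" shows "bounded_linear (sol t)"
proof (rule bounded_linear_intro)
  fix x y r
  have "(\<lambda>n. V n t (x + y)) \<longlonglongrightarrow> sol t x + sol t y"
    using tendsto_add[OF sol_tendsto[OF t, of x] sol_tendsto[OF t, of y]] t by (simp add: yos.mittag_leffler_add)
  then show "sol t (x + y) = sol t x + sol t y"
    using LIMSEQ_unique sol_tendsto[OF t] by blast
  show "sol t (r *\<^sub>R x) = r *\<^sub>R sol t x"
    using t by (intro sol_commute[symmetric] bounded_linear_scaleR_right) (auto simp: scale)
  show "norm (sol t x) \<le> norm x * 1" using norm_sol_le[OF t] by simp
qed

text \<open>
  The domain is the range of \<open>resolvent 1\<close>, and \<open>sol t\<close> commutes with it.
\<close>

lemma sol_domain:
  assumes x: "x \<in> D" and t: "t \<ge> 0"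
  shows "sol t x \<in> D" "A (sol t x) = sol t (A x)"
proof -
  have "resolvent 1 (sol t (x - A x)) = sol t (resolvent 1 (x - A x))"
    using t by (intro sol_commute bounded_linear_resolvent) (auto simp: resolvent_mem resolvent_A)
  also have "resolvent 1 (x - A x) = x" using resolvent_unique[of 1 x] x by simp
  finally have *: "resolvent 1 (sol t (x - A x)) = sol t x" .
  then show "sol t x \<in> D" using resolvent_mem[of 1 "sol t (x - A x)"] by simp
  show "A (sol t x) = sol t (A x)"
    using A_resolvent[of 1 "sol t (x - A x)"] unfolding *
    by (simp add: linear_diff[OF bounded_linear.linear[OF bounded_linear_sol[OF t]]])
qed

text \<open>
  The equations of the approximate solutions pass to the limit, because
  \<open>A\<^sub>n V\<^sub>n x = V\<^sub>n (A\<^sub>n x - A x) + V\<^sub>n (A x)\<close> converges to \<open>sol (A x)\<close> uniformly on compact intervals.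
\<close>

lemma sol_equation:
  assumes x: "x \<in> D" and t: "t \<ge> 0"
  shows "sol t x = x + conv (g \<alpha>) (\<lambda>s. sol s (A x)) t"
proof (rule LIMSEQ_unique[OF sol_tendsto[OF t]])
  have "uniform_limit {0..t} (\<lambda>n s. V n s (yosida n x - A x) + V n s (A x)) (\<lambda>s. 0 + sol s (A x)) sequentially"
  proof (rule uniform_limit_add[OF _ uniform_limit_sol[OF t]], rule uniform_limitI)
    fix \<epsilon> :: real assume "\<epsilon> > 0"
    then have "\<forall>\<^sub>F n in sequentially. dist (yosida n x) (A x) < \<epsilon>"
      using yosida_tendsto[OF x] by (intro tendstoD)
    then show "\<forall>\<^sub>F n in sequentially. \<forall>s\<in>{0..t}. dist (V n s (yosida n x - A x)) 0 < \<epsilon>"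
      by (rule eventually_mono) (auto simp: dist_norm intro: le_less_trans[OF yos.norm_mittag_leffler_le])
  qed
  then have "uniform_limit {0..t} (\<lambda>n s. yosida n (V n s x)) (\<lambda>s. sol s (A x)) sequentially"
    by (rule uniform_limit_cong'[THEN iffD1, rotated 2])
      (auto simp: yosida_V linear_diff[OF bounded_linear.linear[OF yos.bounded_linear_mittag_leffler]])
  then have "(\<lambda>n. conv (g \<alpha>) (\<lambda>s. yosida n (V n s x)) t) \<longlonglongrightarrow> conv (g \<alpha>) (\<lambda>s. sol s (A x)) t"
    using \<alpha> t by (intro conv_tendsto continuous_on_subset[OF yos.continuous_on_B_mittag_leffler]) auto
  then have "(\<lambda>n. x + conv (g \<alpha>) (\<lambda>s. yosida n (V n s x)) t) \<longlonglongrightarrow> x + conv (g \<alpha>) (\<lambda>s. sol s (A x)) t"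
    by (intro tendsto_intros)
  then show "(\<lambda>n. V n t x) \<longlonglongrightarrow> x + conv (g \<alpha>) (\<lambda>s. sol s (A x)) t"
    using yos.mittag_leffler_equation[OF t] by simp
qed

end

section \<open>Uniqueness\<close>

context fractional_problem
begin

text \<open>
  A continuous solution \<open>z\<close> with zero initial value is in general only Hoelder continuous, too little for
  the energy inequality. Its integral \<open>y\<close> is continuously differentiable and solves the same
  equation: integration commutes with the convolution, and with \<open>A\<close> because \<open>A\<close> has a bounded
  resolvent. So \<open>y\<close> vanishes, and with it the derivative \<open>z\<close>.
\<close>

lemma zero_solution:
  assumes zD: "\<And>t. t \<ge> 0 \<Longrightarrow> z t \<in> D" and cz: "continuous_on {0..} z"
    and cAz: "continuous_on {0..} (\<lambda>t. A (z t))"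
    and z: "\<And>t. t \<ge> 0 \<Longrightarrow> (conv (g (1 - \<alpha>)) z has_vector_derivative A (z t)) (at t within {0..})"
    and t: "t \<ge> 0"
  shows "z t = 0"
proof -
  let ?k = "g (1 - \<alpha>)"
  define y where "y r = integral {0..r} z" for r
  have k: "1 - \<alpha> > 0" using \<alpha> by simp
  have cz': "continuous_on {0..r} z" for r by (rule continuous_on_subset[OF cz]) auto
  have cAz': "continuous_on {0..r} (\<lambda>t. A (z t))" for r by (rule continuous_on_subset[OF cAz]) auto
  \<comment> \<open>the equation for \<open>z\<close> in integrated form; both sides vanish at 0\<close>
  have W: "integral {0..r} (\<lambda>s. A (z s)) = conv ?k z r" if "r \<ge> 0" for r
  proof -
    have "((\<lambda>s. A (z s)) has_integral (conv ?k z r - conv ?k z 0)) {0..r}"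
    proof (rule fundamental_theorem_of_calculus_interior[OF that continuous_on_conv[OF k cz']])
      fix s assume s: "s \<in> {0<..<r}"
      then have "at s within {0..} = at s" by (intro at_within_interior) auto
      then show "(conv ?k z has_vector_derivative A (z s)) (at s)" using z[of s] s by simp
    qed
    then show ?thesis by (simp add: integral_unique conv_def)
  qed
  have y: "y r \<in> D \<and> A (y r) = conv ?k z r" if r: "r \<ge> 0" for r
  proof -
    have lin: "bounded_linear (resolvent 1)" by (rule bounded_linear_resolvent) simp
    \<comment> \<open>integrate \<open>z = resolvent 1 (z - A z)\<close>\<close>
    have "y r = integral {0..r} (\<lambda>s. resolvent 1 (z s - A (z s)))"
      unfolding y_def using zD resolvent_unique[of 1] by (intro integral_cong) simp
    also have "\<dots> = resolvent 1 (integral {0..r} (\<lambda>s. z s - A (z s)))"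
      using integral_linear[OF _ lin, of "\<lambda>s. z s - A (z s)"] integrable_continuous[OF continuous_on_diff[OF cz' cAz']]
      by (simp add: o_def)
    also have "integral {0..r} (\<lambda>s. z s - A (z s)) = y r - conv ?k z r"
      unfolding y_def W[OF r, symmetric]
      by (intro integral_diff integrable_continuous cz' cAz')
    finally have *: "y r = resolvent 1 (y r - conv ?k z r)" .
    then have "y r \<in> D" using resolvent_mem[of 1 "y r - conv ?k z r"] by simp
    moreover have "A (y r) = conv ?k z r"
      using A_resolvent[of 1 "y r - conv ?k z r"] by (simp flip: *)
    ultimately show ?thesis ..
  qed
  have y': "(y has_vector_derivative z r) (at r within {0..})" if "r \<ge> 0" for r
    unfolding y_def using cz that by (rule integral_has_derivative_half_line)
  have cy: "continuous_on {0..r} y" for r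
  proof (rule continuous_on_subset)
    show "continuous_on {0..} y"
      using y' by (auto simp: continuous_on_eq_continuous_within intro: has_vector_derivative_continuous)
  qed auto
  have conv_y: "(conv ?k (\<lambda>s. y s - 0) has_vector_derivative A (y r)) (at r within {0..})" if r: "r \<ge> 0" for r
  proof (rule has_vector_derivative_transform[rotated 2])
    have "continuous_on {0..} (conv ?k z)"
      by (intro continuous_on_half_line continuous_on_conv k cz')
    then show "((\<lambda>r. integral {0..r} (conv ?k z)) has_vector_derivative A (y r)) (at r within {0..})"
      using integral_has_derivative_half_line[OF _ r] y[OF r] by simp
    fix s :: real assume "s \<in> {0..}"
    then have s: "s \<ge> 0" by simp
    have "y = conv (g 1) z" by (simp add: y_def conv_g1 fun_eq_iff)
    then have "conv ?k (\<lambda>s. y s - 0) s = conv (g (1 - \<alpha> + 1)) z s"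
      using conv_conv[OF k _ s cz', of 1] by simp
    also have "\<dots> = conv (g 1) (conv ?k z) s"
      using conv_conv[OF _ k s cz', of 1] by (simp add: add.commute)
    finally show "conv ?k (\<lambda>s. y s - 0) s = integral {0..s} (conv ?k z)" by (simp add: conv_g1)
  qed (use r in auto)
  have y0: "y r = 0" if r: "r \<ge> 0" for r
  proof -
    obtain \<tau> where \<tau>: "\<tau> \<in> {0..r}" and max: "\<And>s. s \<in> {0..r} \<Longrightarrow> norm (y s) \<le> norm (y \<tau>)"
      using attains_max_norm[OF cy r] by blast
    have "y \<tau> = 0"
    proof (cases "\<tau> = 0")
      case False
      then have pos: "\<tau> > 0" using \<tau> by auto
      obtain \<sigma> where \<sigma>: "\<And>s. s \<in> {0..\<tau>} \<Longrightarrow> norm (z s) \<le> norm (z \<sigma>)"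
        using attains_max_norm[OF cz' less_imp_le[OF pos]] by blast
      have L: "norm (y \<tau> - y s) \<le> norm (z \<sigma>) * (\<tau> - s)" if s: "s \<in> {\<tau>/2..\<tau>}" for s
      proof -
        have "norm (y \<tau> - y s) \<le> norm (z \<sigma>) * norm (\<tau> - s)"
        proof (rule differentiable_bound[of "{0..\<tau>}" y "\<lambda>s h. h *\<^sub>R z s"])
          fix s assume s: "s \<in> {0..\<tau>}"
          then show "(y has_derivative (\<lambda>h. h *\<^sub>R z s)) (at s within {0..\<tau>})"
            using has_vector_derivative_within_subset[OF y'[of s], of "{0..\<tau>}"]
            by (auto simp: has_vector_derivative_def)
          show "onorm (\<lambda>h. h *\<^sub>R z s) \<le> norm (z \<sigma>)"
            using \<sigma>[OF s] by (intro onorm_le) (simp add: mult.commute[of "norm (z \<sigma>)"] mult_left_mono)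
        qed (use s pos in auto)
        then show ?thesis using s by simp
      qed
      have "g (1 - \<alpha>) \<tau> * ((norm (y \<tau>))\<^sup>2 - 0 \<bullet> y \<tau>) \<le> A (y \<tau>) \<bullet> y \<tau>"
        using \<tau> pos max
        by (intro energy_inequality[OF \<alpha> pos cy _ L] has_vector_derivative_within_subset[OF conv_y]) auto
      also have "\<dots> \<le> 0" using y[of \<tau>] \<tau> by (intro diss) auto
      finally show ?thesis using g_pos[OF k pos] by (simp add: mult_le_0_iff)
    qed (simp add: y_def)
    then show ?thesis using max[of r] r by simp
  qed
  have "((\<lambda>_. 0) has_vector_derivative z t) (at t within {0..})"
    using t y0 by (intro has_vector_derivative_transform[OF _ _ y'[OF t]]) auto
  then have "((\<lambda>_. 0) has_vector_derivative z t) (at t within {0..t + 1})"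
    by (rule has_vector_derivative_within_subset) auto
  then show ?thesis
    using t vector_derivative_unique_within_closed_interval[of 0 "t + 1" t, OF _ _ has_vector_derivative_const, of 0 "z t"]
    by simp
qed

lemma strong_solution_unique:
  assumes u1: "strong_solution \<alpha> \<eta> D A x u1" and u2: "strong_solution \<alpha> \<eta> D A x u2" and t: "t \<ge> 0"
  shows "u1 t = u2 t"
proof -
  let ?k = "g (1 - \<alpha>)"
  obtain w1 where w1: "continuous_on {0..} w1" "\<And>t. t \<ge> 0 \<Longrightarrow> (conv ?k (\<lambda>s. exp (\<eta> * s) *\<^sub>R u1 s - x) has_vector_derivative w1 t) (at t within {0..})"
      "\<And>t. t \<ge> 0 \<Longrightarrow> w1 t = A (exp (\<eta> * t) *\<^sub>R u1 t)"
    using u1 unfolding strong_solution_def by blast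
  obtain w2 where w2: "continuous_on {0..} w2" "\<And>t. t \<ge> 0 \<Longrightarrow> (conv ?k (\<lambda>s. exp (\<eta> * s) *\<^sub>R u2 s - x) has_vector_derivative w2 t) (at t within {0..})"
      "\<And>t. t \<ge> 0 \<Longrightarrow> w2 t = A (exp (\<eta> * t) *\<^sub>R u2 t)"
    using u2 unfolding strong_solution_def by blast
  have c: "continuous_on {0..} u1" "continuous_on {0..} u2"
    using u1 u2 by (auto simp: strong_solution_def)
  have D: "u1 t \<in> D" "u2 t \<in> D" if "t \<ge> 0" for t
    using u1 u2 that by (auto simp: strong_solution_def continuous_in_domain_def)
  define z where "z t = exp (\<eta> * t) *\<^sub>R u1 t - exp (\<eta> * t) *\<^sub>R u2 t" for t
  have z: "z t \<in> D \<and> A (z t) = w1 t - w2 t" if "t \<ge> 0" for t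
    unfolding z_def using diff scale D[OF that] w1(3)[OF that] w2(3)[OF that] by metis
  have "z t = 0"
  proof (rule zero_solution[OF _ _ _ _ t])
    show "z t \<in> D" if "t \<ge> 0" for t using z[OF that] by blast
    show "continuous_on {0..} z"
      unfolding z_def by (intro continuous_intros c)
    have "continuous_on {0..} (\<lambda>t. w1 t - w2 t)" by (intro continuous_intros w1 w2)
    then show "continuous_on {0..} (\<lambda>t. A (z t))" by (rule continuous_on_eq) (simp add: z)
    fix t :: real assume t: "t \<ge> 0"
    have "((\<lambda>r. conv ?k (\<lambda>s. exp (\<eta> * s) *\<^sub>R u1 s - x) r - conv ?k (\<lambda>s. exp (\<eta> * s) *\<^sub>R u2 s - x) r)
        has_vector_derivative w1 t - w2 t) (at t within {0..})"
      by (intro has_vector_derivative_diff w1(2) w2(2) t)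
    then show "(conv ?k z has_vector_derivative A (z t)) (at t within {0..})"
    proof (subst z[OF t, THEN conjunct2], rule has_vector_derivative_transform[rotated 2])
      fix r :: real assume "r \<in> {0..}"
      then have r: "r \<ge> 0" by simp
      have "conv ?k (\<lambda>s. exp (\<eta> * s) *\<^sub>R u1 s - x) r - conv ?k (\<lambda>s. exp (\<eta> * s) *\<^sub>R u2 s - x) r =
          conv ?k (\<lambda>s. (exp (\<eta> * s) *\<^sub>R u1 s - x) - (exp (\<eta> * s) *\<^sub>R u2 s - x)) r"
        using \<alpha> r by (intro conv_diff[symmetric] continuous_intros continuous_on_subset[OF c(1)] continuous_on_subset[OF c(2)]) auto
      then show "conv ?k z r = conv ?k (\<lambda>s. exp (\<eta> * s) *\<^sub>R u1 s - x) r - conv ?k (\<lambda>s. exp (\<eta> * s) *\<^sub>R u2 s - x) r"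
        by (simp add: z_def[abs_def])
    qed (use t in simp)
  qed
  then show ?thesis by (simp add: z_def)
qed

end

section \<open>Solution operator, well-posedness and decay\<close>

context fractional_problem
begin

text \<open>
  Covers both the constructed solution and an arbitrary solution operator, so that uniqueness
  identifies them.
\<close>

lemma strong_solution_of_integral_equation:
  assumes x: "x \<in> D" and f: "continuous_on {0..} f"
    and v: "\<And>t. t \<ge> 0 \<Longrightarrow> exp (\<eta> * t) *\<^sub>R u t = x + conv (g \<alpha>) f t"
    and uD: "\<And>t. t \<ge> 0 \<Longrightarrow> u t \<in> D" and Au: "\<And>t. t \<ge> 0 \<Longrightarrow> exp (\<eta> * t) *\<^sub>R A (u t) = f t"
  shows "strong_solution \<alpha> \<eta> D A x u"
proof -
  have u: "u t = exp (- \<eta> * t) *\<^sub>R (x + conv (g \<alpha>) f t)" if "t \<ge> 0" for t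
    unfolding v[OF that, symmetric] by (simp flip: exp_add)
  have Au': "A (u t) = exp (- \<eta> * t) *\<^sub>R f t" if "t \<ge> 0" for t
    unfolding Au[OF that, symmetric] by (simp flip: exp_add)
  have "continuous_on {0..} (\<lambda>t. exp (- \<eta> * t) *\<^sub>R (x + conv (g \<alpha>) f t))"
    using \<alpha> by (intro continuous_intros continuous_on_half_line[OF continuous_on_conv] continuous_on_subset[OF f]) auto
  then have cu: "continuous_on {0..} u"
    by (rule continuous_on_eq) (simp add: u)
  have "continuous_on {0..} (\<lambda>t. exp (- \<eta> * t) *\<^sub>R f t)"
    by (intro continuous_intros f)
  then have cAu: "continuous_on {0..} (\<lambda>t. A (u t))"
    by (rule continuous_on_eq) (simp add: Au')
  have "((\<lambda>s. graph_norm A (u s - u t)) \<longlongrightarrow> 0) (at t within {0..})" if t: "t \<ge> 0" for t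
  proof -
    have "(u \<longlongrightarrow> u t) (at t within {0..})" "((\<lambda>s. A (u s)) \<longlongrightarrow> A (u t)) (at t within {0..})"
      using cu cAu t by (auto simp: continuous_on_def)
    then have "((\<lambda>s. norm (u s - u t) + norm (A (u s) - A (u t))) \<longlongrightarrow> norm (u t - u t) + norm (A (u t) - A (u t)))
        (at t within {0..})"
      by (intro tendsto_intros)
    moreover have "\<forall>\<^sub>F s in at t within {0..}. norm (u s - u t) + norm (A (u s) - A (u t)) = graph_norm A (u s - u t)"
      unfolding eventually_at_filter using t diff[OF uD uD] by (auto simp: graph_norm_def)
    ultimately show ?thesis by (simp add: tendsto_cong)
  qed
  then have dom: "continuous_in_domain D A u" using uD by (simp add: continuous_in_domain_def)
  have "u 0 = x" using v[of 0] by (simp add: conv_def)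
  moreover have "(conv (g (1 - \<alpha>)) (\<lambda>s. exp (\<eta> * s) *\<^sub>R u s - x) has_vector_derivative f t) (at t within {0..})"
    if "t \<ge> 0" for t
    using that by (intro caputo_derivative_of_integral_equation[OF \<alpha> f] v)
  moreover have "f t = A (exp (\<eta> * t) *\<^sub>R u t)" if "t \<ge> 0" for t
    using that scale[OF uD] by (simp add: Au)
  ultimately show ?thesis
    unfolding strong_solution_def using cu dom f by blast
qed

lemma strong_solution_sol:
  assumes x: "x \<in> D"
  shows "strong_solution \<alpha> \<eta> D A x (\<lambda>t. exp (- \<eta> * t) *\<^sub>R sol t x)"
proof (rule strong_solution_of_integral_equation[OF x continuous_on_sol[of "A x"]])
  fix t :: real assume t: "t \<ge> 0"
  have e: "exp (\<eta> * t) * exp (- \<eta> * t) = 1" by (simp flip: exp_add)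
  show "exp (\<eta> * t) *\<^sub>R exp (- \<eta> * t) *\<^sub>R sol t x = x + conv (g \<alpha>) (\<lambda>s. sol s (A x)) t"
    using sol_equation[OF x t] e by simp
  show "exp (- \<eta> * t) *\<^sub>R sol t x \<in> D"
    using scale[OF sol_domain(1)[OF x t]] by blast
  show "exp (\<eta> * t) *\<^sub>R A (exp (- \<eta> * t) *\<^sub>R sol t x) = sol t (A x)"
    using scale[OF sol_domain(1)[OF x t]] e by (simp add: sol_domain(2)[OF x t])
qed

lemma strong_solution_eq_sol:
  assumes "strong_solution \<alpha> \<eta> D A x u" "x \<in> D" "t \<ge> 0"
  shows "u t = exp (- \<eta> * t) *\<^sub>R sol t x"
  by (rule strong_solution_unique[OF assms(1) strong_solution_sol[OF assms(2)] assms(3)])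

lemma strong_solution_of_solution_operator:
  assumes S: "solution_operator K sc \<alpha> \<eta> D A S" and x: "x \<in> D"
  shows "strong_solution \<alpha> \<eta> D A x (\<lambda>t. S t x)"
proof (rule strong_solution_of_integral_equation[OF x])
  have SD: "S t x \<in> D" "A (S t x) = S t (A x)" if "t \<ge> 0" for t
    using S that x by (auto simp: solution_operator_def)
  have "continuous_on {0..} (\<lambda>t. S t (A x))"
    using S by (auto simp: solution_operator_def)
  then have "continuous_on {0..} (\<lambda>t. exp (\<eta> * t) *\<^sub>R S t (A x))"
    by (intro continuous_intros)
  then show "continuous_on {0..} (\<lambda>t. exp (\<eta> * t) *\<^sub>R A (S t x))"
    by (rule continuous_on_eq) (simp add: SD)
  fix t :: real assume t: "t \<ge> 0"
  show "S t x \<in> D" by (rule SD(1)[OF t])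
  have "S t x = exp (- \<eta> * t) *\<^sub>R x + exp (- \<eta> * t) *\<^sub>R conv (g \<alpha>) (\<lambda>s. exp (\<eta> * s) *\<^sub>R A (S s x)) t"
    using S x t unfolding solution_operator_def by blast
  also have "\<dots> = exp (- \<eta> * t) *\<^sub>R (x + conv (g \<alpha>) (\<lambda>s. exp (\<eta> * s) *\<^sub>R A (S s x)) t)"
    by (simp add: scaleR_add_right)
  finally have "exp (\<eta> * t) *\<^sub>R S t x =
      exp (\<eta> * t) *\<^sub>R exp (- \<eta> * t) *\<^sub>R (x + conv (g \<alpha>) (\<lambda>s. exp (\<eta> * s) *\<^sub>R A (S s x)) t)"
    by (rule arg_cong)
  then show "exp (\<eta> * t) *\<^sub>R S t x = x + conv (g \<alpha>) (\<lambda>s. exp (\<eta> * s) *\<^sub>R A (S s x)) t"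
    by (simp flip: exp_add)
qed simp

lemma norm_strong_solution_le:
  assumes "strong_solution \<alpha> \<eta> D A x u" "x \<in> D" "t \<ge> 0"
  shows "norm (u t) \<le> exp (- \<eta> * t) * norm x"
  using norm_sol_le[OF assms(3), of x] by (simp add: strong_solution_eq_sol[OF assms])

lemma fractional_problem_well_posed:
  assumes \<eta>: "0 \<le> \<eta>"
  shows "well_posed \<alpha> \<eta> D A"
  unfolding well_posed_def
proof (intro conjI ballI allI impI)
  show "\<exists>u. strong_solution \<alpha> \<eta> D A x u" if "x \<in> D" for x
    using strong_solution_sol[OF that] by blast
  show "u t = v t" if "x \<in> D" "strong_solution \<alpha> \<eta> D A x u" "strong_solution \<alpha> \<eta> D A x v" "t \<ge> 0" for x u v t
    using strong_solution_unique that(2-4) by blast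
  fix u0 u and T :: real
  assume u: "\<forall>n::nat. u0 n \<in> D \<and> strong_solution \<alpha> \<eta> D A (u0 n) (u n)" and lim: "u0 \<longlonglongrightarrow> 0"
  show "uniform_limit {0..T} u (\<lambda>_. 0) sequentially"
  proof (rule uniform_limitI)
    fix \<epsilon> :: real assume "\<epsilon> > 0"
    with lim have "\<forall>\<^sub>F n in sequentially. dist (u0 n) 0 < \<epsilon>" by (rule tendstoD)
    then show "\<forall>\<^sub>F n in sequentially. \<forall>t\<in>{0..T}. dist (u n t) 0 < \<epsilon>"
    proof (rule eventually_mono, intro ballI)
      fix n t assume n: "dist (u0 n) 0 < \<epsilon>" and t: "t \<in> {0..T}"
      have "norm (u n t) \<le> exp (- \<eta> * t) * norm (u0 n)"
        using u t by (intro norm_strong_solution_le) auto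
      also have "\<dots> \<le> norm (u0 n)" using \<eta> t by (simp add: mult_left_le_one_le)
      finally show "dist (u n t) 0 < \<epsilon>" using n by simp
    qed
  qed
qed

end

text \<open>
  A scalar multiplies norms by its modulus, as the scalar product is sesquilinear.
\<close>

lemma bounded_linear_sc:
  assumes "hilbert_space K sc ip" and c: "c \<in> K"
  shows "bounded_linear (sc c)"
proof -
  interpret hilbert_space K sc ip by (rule assms(1))
  show ?thesis
  proof (rule bounded_linear_intro)
    fix x y :: 'a and r :: real
    show "sc c (x + y) = sc c x + sc c y" by (rule sc_add_right[OF c])
    have r: "complex_of_real r \<in> K" using scalars by auto
    show "sc c (r *\<^sub>R x) = r *\<^sub>R sc c x"
      using sc_mult[OF c r, of x] sc_mult[OF r c, of x] by (simp add: sc_of_real mult.commute)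
    have "ip (sc c x) (sc c x) = c * cnj c * ip x x"
      using ip_sc_left[OF c, of x x] ip_sc_left[OF c, of x "sc c x"] ip_commute[of x "sc c x"] ip_commute[of x x]
      by simp
    then have "Re (ip (sc c x) (sc c x)) = Re (of_real ((cmod c)\<^sup>2) * ip x x)"
      by (simp only: complex_norm_square)
    then have "(norm (sc c x))\<^sup>2 = (cmod c * norm x)\<^sup>2"
      by (simp add: Re_ip power2_norm_eq_inner power_mult_distrib)
    then show "norm (sc c x) \<le> norm x * cmod c"
      by (simp add: mult.commute)
  qed
qed

lemma (in fractional_problem) solution_operator_exists:
  assumes hs: "hilbert_space K sc ip" and lin: "linear_operator K sc D A"
  shows "solution_operator K sc \<alpha> \<eta> D A (\<lambda>t x. exp (- \<eta> * t) *\<^sub>R sol t x)"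
  unfolding solution_operator_def
proof (intro conjI ballI allI impI)
  fix t :: real assume t: "t \<ge> 0"
  have "sol t (sc c x) = sc c (sol t x)" if "c \<in> K" for c x
    using lin that by (intro sol_commute[symmetric] bounded_linear_sc[OF hs] t) (auto simp: linear_operator_def)
  then show "bounded_operator K sc (\<lambda>x. exp (- \<eta> * t) *\<^sub>R sol t x)"
    unfolding bounded_operator_def
    by (auto intro!: bounded_linear_const_scaleR bounded_linear_sol t
        simp: linear_cmul[OF bounded_linear.linear[OF bounded_linear_sc[OF hs]]])
next
  fix x
  show "continuous_on {0..} (\<lambda>t. exp (- \<eta> * t) *\<^sub>R sol t x)"
    by (intro continuous_intros continuous_on_sol)
  show "exp (- \<eta> * 0) *\<^sub>R sol 0 x = x" by (simp add: sol_0)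
next
  fix t :: real and x assume t: "t \<ge> 0" and x: "x \<in> D"
  show "exp (- \<eta> * t) *\<^sub>R sol t x \<in> D"
    and A: "A (exp (- \<eta> * t) *\<^sub>R sol t x) = exp (- \<eta> * t) *\<^sub>R sol t (A x)"
    using scale[OF sol_domain(1)[OF x t]] sol_domain(2)[OF x t] by auto
  have "conv (g \<alpha>) (\<lambda>s. sol s (A x)) t = conv (g \<alpha>) (\<lambda>s. exp (\<eta> * s) *\<^sub>R A (exp (- \<eta> * s) *\<^sub>R sol s x)) t"
  proof (rule conv_cong)
    fix s assume "s \<in> {0..t}"
    then have s: "s \<ge> 0" by simp
    then show "sol s (A x) = exp (\<eta> * s) *\<^sub>R A (exp (- \<eta> * s) *\<^sub>R sol s x)"
      using scale[OF sol_domain(1)[OF x s]] by (simp add: sol_domain(2)[OF x s] flip: exp_add)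
  qed
  then show "exp (- \<eta> * t) *\<^sub>R sol t x = exp (- \<eta> * t) *\<^sub>R x +
      exp (- \<eta> * t) *\<^sub>R conv (g \<alpha>) (\<lambda>s. exp (\<eta> * s) *\<^sub>R A (exp (- \<eta> * s) *\<^sub>R sol s x)) t"
    using sol_equation[OF x t] by (simp add: scaleR_add_right)
qed

text \<open>
  Real scalars belong to either scalar field, and the real inner product is the real part of \<open>ip\<close>.
\<close>

lemma fractional_problem_of_m_dissipative:
  assumes hs: "hilbert_space K sc ip" and \<alpha>: "0 < \<alpha>" "\<alpha> < 1" and m: "m_dissipative K sc ip D A"
  shows "fractional_problem D A \<alpha>"
proof unfold_locales
  interpret hilbert_space K sc ip by (rule hs)
  have lin: "linear_operator K sc D A" using m by (simp add: m_dissipative_def)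
  show "x + y \<in> D \<and> A (x + y) = A x + A y" if "x \<in> D" "y \<in> D" for x y
    using lin that by (simp add: linear_operator_def)
  show "r *\<^sub>R x \<in> D \<and> A (r *\<^sub>R x) = r *\<^sub>R A x" if "x \<in> D" for x r
  proof -
    have "complex_of_real r \<in> K" using scalars by auto
    then have "sc (complex_of_real r) x \<in> D \<and> A (sc (complex_of_real r) x) = sc (complex_of_real r) (A x)"
      using lin that by (simp add: linear_operator_def)
    then show ?thesis by (simp add: sc_of_real)
  qed
  show "A x \<bullet> x \<le> 0" if "x \<in> D" for x
    using m that by (simp add: m_dissipative_def dissipative_def Re_ip)
  show "\<exists>r>0. (\<lambda>x. r *\<^sub>R x - A x) ` D = UNIV"
    using m by (simp add: m_dissipative_def)
qed (use \<alpha> in auto)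

theorem theorem2p1:
  fixes K :: "complex set"
    and sc :: "complex \<Rightarrow> 'a::{real_inner,complete_space} \<Rightarrow> 'a"
    and ip :: "'a \<Rightarrow> 'a \<Rightarrow> complex"
    and \<alpha> \<eta> :: real
    and D :: "'a set" and A :: "'a \<Rightarrow> 'a"
  assumes "hilbert_space K sc ip"
    and "0 < \<alpha>" "\<alpha> < 1" "0 \<le> \<eta>"
    and "m_dissipative K sc ip D A"
  shows "(\<exists>S. solution_operator K sc \<alpha> \<eta> D A S) \<and>
    well_posed \<alpha> \<eta> D A \<and>
    (\<eta> > 0 \<longrightarrow> (\<forall>S. solution_operator K sc \<alpha> \<eta> D A S \<longrightarrow>
       (\<exists>M>0. \<forall>u0\<in>D. \<forall>t\<ge>0. norm (S t u0) \<le> M * exp (- \<eta> * t) * norm u0)))"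
proof -
  interpret fractional_problem D A \<alpha>
    by (rule fractional_problem_of_m_dissipative[OF assms(1-3,5)])
  have lin: "linear_operator K sc D A" using assms(5) by (simp add: m_dissipative_def)
  have "\<exists>M>0. \<forall>u0\<in>D. \<forall>t\<ge>0. norm (S t u0) \<le> M * exp (- \<eta> * t) * norm u0"
    if "solution_operator K sc \<alpha> \<eta> D A S" for S
    using norm_strong_solution_le[OF strong_solution_of_solution_operator[OF that]]
    by (intro exI[of _ 1]) simp
  then show ?thesis
    using solution_operator_exists[OF assms(1) lin] fractional_problem_well_posed[OF assms(4)] by blast
qed

end
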